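(* Let $f\in C^2(\mathbb{R}^n,\mathbb{R})$ and $F_1,F_2\in C^2(\mathbb{R}^n,\mathbb{R}^\kappa)$ be the defining functions of MPCC, and let $\mathcal{S}^=_t$, with feasible set $M^{\mathcal{S}^=}_t$, be its smoothing with parameter $t>0$. Suppose a sequence of nondegenerate Karush-Kuhn-Tucker points $x^t\in M^{\mathcal{S}^=}_t$ of $\mathcal{S}^=_t$, all with quadratic index $q$, converges to $\bar x$ for $t\to0$ (i.e. along some sequence of positive parameters $t$ tending to $0$). If $\bar x\in M$ is a nondegenerate C-stationary point of MPCC with multipliers $(\bar\sigma,\bar\varrho)$, then its C-index satisfies $CI=q$.
   Context: **MPCC.** $\min_x f(x)$ s.t. $x\in M$, where $M=\{x\in\mathbb{R}^n\mid F_{1,j}(x)F_{2,j}(x)=0,\ F_{1,j}(x)\ge 0,\ F_{2,j}(x)\ge 0,\ j=1,\dots,\kappa\}$. $D$ and $D^2$ denote differential and Hessian. For $\bar x\in M$ put $a_{01}(\bar x)=\{j\mid F_{1,j}(\bar x)=0,F_{2,j}(\bar x)>0\}$, $a_{10}(\bar x)=\{j\mid F_{1,j}(\bar x)>0,F_{2,j}(\bar x)=0\}$, $a_{00}(\bar x)=\{j\mid F_{1,j}(\bar x)=0,F_{2,j}(\bar x)=0\}$. **C-stationarity.** $\bar x\in M$ is C-stationary with multipliers $(\bar\sigma,\bar\varrho)$, consisting of $\bar\sigma_{1,j}$ ($j\in a_{01}(\bar x)$), $\bar\sigma_{2,j}$ ($j\in a_{10}(\bar x)$), $\bar\varrho_{1,j},\bar\varrho_{2,j}$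 ($j\in a_{00}(\bar x)$), if $$Df(\bar x)=\sum_{j\in a_{01}(\bar x)}\bar\sigma_{1,j}DF_{1,j}(\bar x)+\sum_{j\in a_{10}(\bar x)}\bar\sigma_{2,j}DF_{2,j}(\bar x)+\sum_{j\in a_{00}(\bar x)}\big(\bar\varrho_{1,j}DF_{1,j}(\bar x)+\bar\varrho_{2,j}DF_{2,j}(\bar x)\big)$$ and $\bar\varrho_{1,j}\bar\varrho_{2,j}\ge 0$ for all $j\in a_{00}(\bar x)$. The Lagrange function is $$L(x)=f(x)-\sum_{j\in a_{01}(\bar x)}\bar\sigma_{1,j}F_{1,j}(x)-\sum_{j\in a_{10}(\bar x)}\bar\sigma_{2,j}F_{2,j}(x)-\sum_{j\in a_{00}(\bar x)}\big(\bar\varrho_{1,j}F_{1,j}(x)+\bar\varrho_{2,j}F_{2,j}(x)\big),$$ and the tangent space is $\mathcal{T}_{\bar x}=\{\xi\in\mathbb{R}^n\mid DF_{1,j}(\bar x)\xi=0,\ j\in a_{01}(\bar x)\cup a_{00}(\bar x);\ DF_{2,j}(\bar x)\xi=0,\ j\in a_{10}(\bar x)\cup a_{00}(\bar x)\}$. A C-stationary point $\bar x$ with multipliers $(\bar\sigma,\bar\varrho)$ is **nondegenerate** if - NDC1: MPCC-LICQ holds, i.e. the vectors $DF_{1,j}(\bar x)$, $j\in a_{01}(\bar x)\cup a_{00}(\bar x)$, $DF_{2,j}(\bar x)$, $j\in a_{10}(\bar x)\cup a_{00}(\bar x)$, are linearly independent (so the multipliers are unique); - NDC2: $\bar\varrho_{1,j}\bar\varrho_{2,j}>0$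 for all $j\in a_{00}(\bar x)$; - NDC3: the restricted Hessian $D^2L(\bar x)\restriction_{\mathcal{T}_{\bar x}}$ is nonsingular. **C-index** of a nondegenerate C-stationary point: $CI=QI+BI$, where $QI$ is the number of negative eigenvalues of $D^2L(\bar x)\restriction_{\mathcal{T}_{\bar x}}$ and $BI$ is the number of $j\in a_{00}(\bar x)$ with $\bar\varrho_{1,j},\bar\varrho_{2,j}<0$. **Smoothing** $\mathcal{S}^=_t$, $t>0$: $\min_x f(x)$ s.t. $x\in M^{\mathcal{S}^=}_t=\{x\in\mathbb{R}^n\mid F_{1,j}(x)F_{2,j}(x)=t,\ F_{1,j}(x)\ge0,\ F_{2,j}(x)\ge0,\ j=1,\dots,\kappa\}$. Since $t>0$, the inequality constraints are never active at feasible points, so the standard nonlinear programming notions read as follows. A point $x\in M^{\mathcal{S}^=}_t$ is a **Karush-Kuhn-Tucker point** if there are multipliers $\eta_j\in\mathbb{R}$ (of arbitrary sign), $j=1,\dots,\kappa$, with $$Df(x)=-\sum_{j=1}^\kappa\eta_j\big(F_{2,j}(x)DF_{1,j}(x)+F_{1,j}(x)DF_{2,j}(x)\big).$$ It is **nondegenerate** if the vectors $F_{2,j}(x)DF_{1,j}(x)+F_{1,j}(x)DF_{2,j}(x)$, $j=1,\dots,\kappa$, are linearly independent (LICQ) and the Hessian at $x$ of $L^{\mathcal{S}^=}(\cdot)=f(\cdot)-\sum_{j=1}^\kappa\eta_j\,(t-F_{1,j}(\cdot)F_{2,j}(\cdot))$ (multipliers fixed), restricted to the tangent space $\{\xi\in\mathbb{R}^n\mid(F_{2,j}(x)DF_{1,j}(x)+F_{1,j}(x)DF_{2,j}(x))\xi=0,\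 j=1,\dots,\kappa\}$, is nonsingular. (Strict complementarity of active inequality multipliers is vacuous here.) Its **quadratic index** is the number of negative eigenvalues of this restricted Hessian. *)

theory Defs
  imports "HOL-Analysis.Analysis"
begin

text \<open>For differentiable \<open>f\<close>, the differential satisfies \<open>Df(x) \<xi> = grad f x \<bullet> \<xi>\<close>.\<close>

definition grad :: "(real^'n \<Rightarrow> real) \<Rightarrow> real^'n \<Rightarrow> real^'n" where
  "grad f x = (\<chi> i. frechet_derivative f (at x) (axis i 1))"

definition hessian :: "(real^'n \<Rightarrow> real) \<Rightarrow> real^'n \<Rightarrow> real^'n^'n" where
  "hessian f x = jacobian (grad f) (at x)"

definition C2 :: "(real^'n \<Rightarrow> real) \<Rightarrow> bool" where
  "C2 f \<longleftrightarrow> (\<forall>x. f differentiable (at x)) \<and> (\<forall>x. grad f differentiable (at x))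
      \<and> continuous_on UNIV (hessian f)"

definition C2_vec :: "(real^'n \<Rightarrow> real^'k) \<Rightarrow> bool" where
  "C2_vec F \<longleftrightarrow> (\<forall>j. C2 (\<lambda>x. F x $ j))"

text \<open>A family with a repeated vector is dependent, hence the injectivity.\<close>

definition independent_family :: "('i \<Rightarrow> 'a::real_vector) \<Rightarrow> 'i set \<Rightarrow> bool" where
  "independent_family v I \<longleftrightarrow> inj_on v I \<and> independent (v ` I)"

text \<open>
  The restriction of the symmetric matrix \<open>A\<close>, read as a quadratic form, to a subspace \<open>T\<close> is the
  self-adjoint operator on \<open>T\<close> that applies \<open>A\<close> and then projects orthogonally onto \<open>T\<close>.  If the
  columns of \<open>V\<close> form an orthonormal basis of \<open>T\<close>, its matrix is \<open>V\<^sup>T A V\<close>.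
  On a subspace, \<^const>\<open>closest_point\<close> is the orthogonal projection.
\<close>

definition restricted :: "real^'n^'n \<Rightarrow> (real^'n) set \<Rightarrow> real^'n \<Rightarrow> real^'n" where
  "restricted A T \<xi> = closest_point T (A *v \<xi>)"

definition nonsingular_on :: "real^'n^'n \<Rightarrow> (real^'n) set \<Rightarrow> bool" where
  "nonsingular_on A T \<longleftrightarrow> bij_betw (restricted A T) T T"

definition eigenspace_on :: "real^'n^'n \<Rightarrow> (real^'n) set \<Rightarrow> real \<Rightarrow> (real^'n) set" where
  "eigenspace_on A T l = {\<xi> \<in> T. restricted A T \<xi> = l *\<^sub>R \<xi>}"

definition eigenvalues_on :: "real^'n^'n \<Rightarrow> (real^'n) set \<Rightarrow> real set" where
  "eigenvalues_on A T = {l. \<exists>\<xi>\<in>eigenspace_on A T l. \<xi> \<noteq> 0}"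

text \<open>
  Eigenvalues are counted with multiplicity.  For symmetric \<open>A\<close> geometric and algebraic
  multiplicities coincide, and the index set of the sum is finite because eigenvectors of the
  restriction to different eigenvalues are orthogonal.
\<close>

definition num_neg_eigenvalues :: "real^'n^'n \<Rightarrow> (real^'n) set \<Rightarrow> nat" where
  "num_neg_eigenvalues A T = (\<Sum>l | l \<in> eigenvalues_on A T \<and> l < 0. dim (eigenspace_on A T l))"

definition feasible :: "(real^'n \<Rightarrow> real^'k) \<Rightarrow> (real^'n \<Rightarrow> real^'k) \<Rightarrow> (real^'n) set" where
  "feasible F1 F2 = {x. \<forall>j. F1 x $ j * F2 x $ j = 0 \<and> F1 x $ j \<ge> 0 \<and> F2 x $ j \<ge> 0}"

definition a01 :: "(real^'n \<Rightarrow> real^'k) \<Rightarrow> (real^'n \<Rightarrow> real^'k) \<Rightarrow> real^'n \<Rightarrow> 'k set" where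
  "a01 F1 F2 x = {j. F1 x $ j = 0 \<and> F2 x $ j > 0}"

definition a10 :: "(real^'n \<Rightarrow> real^'k) \<Rightarrow> (real^'n \<Rightarrow> real^'k) \<Rightarrow> real^'n \<Rightarrow> 'k set" where
  "a10 F1 F2 x = {j. F1 x $ j > 0 \<and> F2 x $ j = 0}"

definition a00 :: "(real^'n \<Rightarrow> real^'k) \<Rightarrow> (real^'n \<Rightarrow> real^'k) \<Rightarrow> real^'n \<Rightarrow> 'k set" where
  "a00 F1 F2 x = {j. F1 x $ j = 0 \<and> F2 x $ j = 0}"

text \<open>
  Multipliers are total functions of the index.  Only the values of \<open>\<sigma>1\<close> on \<open>a01\<close>, of \<open>\<sigma>2\<close> on
  \<open>a10\<close> and of \<open>\<rho>1\<close>, \<open>\<rho>2\<close> on \<open>a00\<close> are ever used.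
\<close>

definition C_stationary ::
  "(real^'n \<Rightarrow> real) \<Rightarrow> (real^'n \<Rightarrow> real^'k) \<Rightarrow> (real^'n \<Rightarrow> real^'k) \<Rightarrow> real^'n
    \<Rightarrow> ('k \<Rightarrow> real) \<Rightarrow> ('k \<Rightarrow> real) \<Rightarrow> ('k \<Rightarrow> real) \<Rightarrow> ('k \<Rightarrow> real) \<Rightarrow> bool" where
  "C_stationary f F1 F2 xbar \<sigma>1 \<sigma>2 \<rho>1 \<rho>2 \<longleftrightarrow>
     xbar \<in> feasible F1 F2 \<and>
     grad f xbar =
         (\<Sum>j\<in>a01 F1 F2 xbar. \<sigma>1 j *\<^sub>R grad (\<lambda>y. F1 y $ j) xbar)
       + (\<Sum>j\<in>a10 F1 F2 xbar. \<sigma>2 j *\<^sub>R grad (\<lambda>y. F2 y $ j) xbar)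
       + (\<Sum>j\<in>a00 F1 F2 xbar. \<rho>1 j *\<^sub>R grad (\<lambda>y. F1 y $ j) xbar
                              + \<rho>2 j *\<^sub>R grad (\<lambda>y. F2 y $ j) xbar) \<and>
     (\<forall>j\<in>a00 F1 F2 xbar. \<rho>1 j * \<rho>2 j \<ge> 0)"

definition lagrangian ::
  "(real^'n \<Rightarrow> real) \<Rightarrow> (real^'n \<Rightarrow> real^'k) \<Rightarrow> (real^'n \<Rightarrow> real^'k) \<Rightarrow> real^'n
    \<Rightarrow> ('k \<Rightarrow> real) \<Rightarrow> ('k \<Rightarrow> real) \<Rightarrow> ('k \<Rightarrow> real) \<Rightarrow> ('k \<Rightarrow> real) \<Rightarrow> real^'n \<Rightarrow> real" where
  "lagrangian f F1 F2 xbar \<sigma>1 \<sigma>2 \<rho>1 \<rho>2 x =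
     f x - (\<Sum>j\<in>a01 F1 F2 xbar. \<sigma>1 j * F1 x $ j)
         - (\<Sum>j\<in>a10 F1 F2 xbar. \<sigma>2 j * F2 x $ j)
         - (\<Sum>j\<in>a00 F1 F2 xbar. \<rho>1 j * F1 x $ j + \<rho>2 j * F2 x $ j)"

definition tangent_space ::
  "(real^'n \<Rightarrow> real^'k) \<Rightarrow> (real^'n \<Rightarrow> real^'k) \<Rightarrow> real^'n \<Rightarrow> (real^'n) set" where
  "tangent_space F1 F2 xbar =
     {\<xi>. (\<forall>j \<in> a01 F1 F2 xbar \<union> a00 F1 F2 xbar. grad (\<lambda>y. F1 y $ j) xbar \<bullet> \<xi> = 0) \<and>
         (\<forall>j \<in> a10 F1 F2 xbar \<union> a00 F1 F2 xbar. grad (\<lambda>y. F2 y $ j) xbar \<bullet> \<xi> = 0)}"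

definition MPCC_LICQ ::
  "(real^'n \<Rightarrow> real^'k) \<Rightarrow> (real^'n \<Rightarrow> real^'k) \<Rightarrow> real^'n \<Rightarrow> bool" where
  "MPCC_LICQ F1 F2 xbar \<longleftrightarrow>
     independent_family
       (case_sum (\<lambda>j. grad (\<lambda>y. F1 y $ j) xbar) (\<lambda>j. grad (\<lambda>y. F2 y $ j) xbar))
       ((a01 F1 F2 xbar \<union> a00 F1 F2 xbar) <+> (a10 F1 F2 xbar \<union> a00 F1 F2 xbar))"

definition nondegenerate_C_stationary ::
  "(real^'n \<Rightarrow> real) \<Rightarrow> (real^'n \<Rightarrow> real^'k) \<Rightarrow> (real^'n \<Rightarrow> real^'k) \<Rightarrow> real^'n
    \<Rightarrow> ('k \<Rightarrow> real) \<Rightarrow> ('k \<Rightarrow> real) \<Rightarrow> ('k \<Rightarrow> real) \<Rightarrow> ('k \<Rightarrow> real) \<Rightarrow> bool" where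
  "nondegenerate_C_stationary f F1 F2 xbar \<sigma>1 \<sigma>2 \<rho>1 \<rho>2 \<longleftrightarrow>
     C_stationary f F1 F2 xbar \<sigma>1 \<sigma>2 \<rho>1 \<rho>2 \<and>
     MPCC_LICQ F1 F2 xbar \<and>
     (\<forall>j\<in>a00 F1 F2 xbar. \<rho>1 j * \<rho>2 j > 0) \<and>
     nonsingular_on (hessian (lagrangian f F1 F2 xbar \<sigma>1 \<sigma>2 \<rho>1 \<rho>2) xbar)
       (tangent_space F1 F2 xbar)"

definition QI ::
  "(real^'n \<Rightarrow> real) \<Rightarrow> (real^'n \<Rightarrow> real^'k) \<Rightarrow> (real^'n \<Rightarrow> real^'k) \<Rightarrow> real^'n
    \<Rightarrow> ('k \<Rightarrow> real) \<Rightarrow> ('k \<Rightarrow> real) \<Rightarrow> ('k \<Rightarrow> real) \<Rightarrow> ('k \<Rightarrow> real) \<Rightarrow> nat" where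
  "QI f F1 F2 xbar \<sigma>1 \<sigma>2 \<rho>1 \<rho>2 =
     num_neg_eigenvalues (hessian (lagrangian f F1 F2 xbar \<sigma>1 \<sigma>2 \<rho>1 \<rho>2) xbar)
       (tangent_space F1 F2 xbar)"

definition BI ::
  "(real^'n \<Rightarrow> real^'k) \<Rightarrow> (real^'n \<Rightarrow> real^'k) \<Rightarrow> real^'n
    \<Rightarrow> ('k \<Rightarrow> real) \<Rightarrow> ('k \<Rightarrow> real) \<Rightarrow> nat" where
  "BI F1 F2 xbar \<rho>1 \<rho>2 = card {j \<in> a00 F1 F2 xbar. \<rho>1 j < 0 \<and> \<rho>2 j < 0}"

definition CI ::
  "(real^'n \<Rightarrow> real) \<Rightarrow> (real^'n \<Rightarrow> real^'k) \<Rightarrow> (real^'n \<Rightarrow> real^'k) \<Rightarrow> real^'n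
    \<Rightarrow> ('k \<Rightarrow> real) \<Rightarrow> ('k \<Rightarrow> real) \<Rightarrow> ('k \<Rightarrow> real) \<Rightarrow> ('k \<Rightarrow> real) \<Rightarrow> nat" where
  "CI f F1 F2 xbar \<sigma>1 \<sigma>2 \<rho>1 \<rho>2 =
     QI f F1 F2 xbar \<sigma>1 \<sigma>2 \<rho>1 \<rho>2 + BI F1 F2 xbar \<rho>1 \<rho>2"

definition feasible_S ::
  "(real^'n \<Rightarrow> real^'k) \<Rightarrow> (real^'n \<Rightarrow> real^'k) \<Rightarrow> real \<Rightarrow> (real^'n) set" where
  "feasible_S F1 F2 t = {x. \<forall>j. F1 x $ j * F2 x $ j = t \<and> F1 x $ j \<ge> 0 \<and> F2 x $ j \<ge> 0}"

definition constraint_grad_S ::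
  "(real^'n \<Rightarrow> real^'k) \<Rightarrow> (real^'n \<Rightarrow> real^'k) \<Rightarrow> real^'n \<Rightarrow> 'k \<Rightarrow> real^'n" where
  "constraint_grad_S F1 F2 x j =
     F2 x $ j *\<^sub>R grad (\<lambda>y. F1 y $ j) x + F1 x $ j *\<^sub>R grad (\<lambda>y. F2 y $ j) x"

text \<open>
  For \<open>t > 0\<close> the inequality constraints are inactive at feasible points, so they carry no
  multipliers in the following definitions.
\<close>

definition KKT_S ::
  "(real^'n \<Rightarrow> real) \<Rightarrow> (real^'n \<Rightarrow> real^'k) \<Rightarrow> (real^'n \<Rightarrow> real^'k) \<Rightarrow> real
    \<Rightarrow> real^'n \<Rightarrow> ('k \<Rightarrow> real) \<Rightarrow> bool" where
  "KKT_S f F1 F2 t x \<eta> \<longleftrightarrow>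
     x \<in> feasible_S F1 F2 t \<and>
     grad f x = - (\<Sum>j\<in>UNIV. \<eta> j *\<^sub>R constraint_grad_S F1 F2 x j)"

definition lagrangian_S ::
  "(real^'n \<Rightarrow> real) \<Rightarrow> (real^'n \<Rightarrow> real^'k) \<Rightarrow> (real^'n \<Rightarrow> real^'k) \<Rightarrow> real
    \<Rightarrow> ('k \<Rightarrow> real) \<Rightarrow> real^'n \<Rightarrow> real" where
  "lagrangian_S f F1 F2 t \<eta> x = f x - (\<Sum>j\<in>UNIV. \<eta> j * (t - F1 x $ j * F2 x $ j))"

definition tangent_space_S ::
  "(real^'n \<Rightarrow> real^'k) \<Rightarrow> (real^'n \<Rightarrow> real^'k) \<Rightarrow> real^'n \<Rightarrow> (real^'n) set" where
  "tangent_space_S F1 F2 x = {\<xi>. \<forall>j. constraint_grad_S F1 F2 x j \<bullet> \<xi> = 0}"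

definition nondegenerate_KKT_S ::
  "(real^'n \<Rightarrow> real) \<Rightarrow> (real^'n \<Rightarrow> real^'k) \<Rightarrow> (real^'n \<Rightarrow> real^'k) \<Rightarrow> real
    \<Rightarrow> real^'n \<Rightarrow> ('k \<Rightarrow> real) \<Rightarrow> bool" where
  "nondegenerate_KKT_S f F1 F2 t x \<eta> \<longleftrightarrow>
     KKT_S f F1 F2 t x \<eta> \<and>
     independent_family (constraint_grad_S F1 F2 x) UNIV \<and>
     nonsingular_on (hessian (lagrangian_S f F1 F2 t \<eta>) x) (tangent_space_S F1 F2 x)"

definition quadratic_index_S ::
  "(real^'n \<Rightarrow> real) \<Rightarrow> (real^'n \<Rightarrow> real^'k) \<Rightarrow> (real^'n \<Rightarrow> real^'k) \<Rightarrow> real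
    \<Rightarrow> real^'n \<Rightarrow> ('k \<Rightarrow> real) \<Rightarrow> nat" where
  "quadratic_index_S f F1 F2 t x \<eta> =
     num_neg_eigenvalues (hessian (lagrangian_S f F1 F2 t \<eta>) x) (tangent_space_S F1 F2 x)"

end

theory Submission
  imports Defs
begin

text \<open>
  The index of a restricted Hessian is determined by subspaces: a subspace on which the form is
  negative definite has dimension at most the number of negative eigenvalues, and one on which it is
  positive definite at most the number of the others.  So it is enough to find, in the tangent space
  of the smoothed problem at some \<open>x\<^sup>t\<close>, a negative definite subspace of dimension at least the
  C-index and a positive definite subspace of complementary dimension.

  Write the Karush-Kuhn-Tucker equation as \<open>Df = \<Sum> (\<mu>1 DF1 + \<mu>2 DF2)\<close> with \<open>\<mu>1 = - \<eta> F2\<close> and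
  \<open>\<mu>2 = - \<eta> F1\<close>.  MPCC-LICQ forces \<open>\<mu>1\<close>, \<open>\<mu>2\<close> to converge to the multipliers of the C-stationary
  point (\<open>complementarity_multipliers_tendsto\<close>).  The Hessian of the smoothed Lagrange function is
  therefore the sum of a part that converges to the Hessian of the MPCC Lagrange function and of the
  mixed terms \<open>2 \<eta> (DF1 \<xi>) (DF2 \<xi>)\<close> (\<open>hessian_lagrangian_S\<close>).  On the tangent space the mixed terms
  of indices in \<open>a01\<close> and \<open>a10\<close> vanish in the limit, while a biactive index contributes
  \<open>2 (\<mu>1 / F1) (DF1 \<xi>)\<^sup>2\<close>, which by NDC2 tends to \<open>+\<infinity>\<close> or to \<open>-\<infinity>\<close> with the sign of \<open>\<rho>1\<close>
  unless \<open>DF1 \<xi>\<close> tends to zero.  Each biactive index thus adds one direction to the tangent space of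
  the limit problem, a negative one exactly if its two multipliers are negative: this is where \<open>BI\<close>
  comes from.

  To make this rigorous, the desired subspaces are defined by linear equations at \<open>x\<^sup>t\<close>, namely
  tangency, \<open>DF1 \<xi> = 0\<close> at the biactive indices of the wrong sign, and orthogonality to the part of
  the limiting tangent space on which the limiting form has the wrong sign
  (\<open>inertia_splitting_exists\<close>).  Counting equations bounds the dimensions from below, and a compactness
  argument shows that the forms are eventually definite on these subspaces
  (\<open>limit_of_tangent_directions\<close>, \<open>eventually_definite_subspace\<close>).
\<close>

section \<open>Inertia of a quadratic form on a subspace\<close>

text \<open>
  Maximising the Rayleigh quotient over the compact unit sphere of an invariant subspace gives an
  eigenvector there: at the maximum, the first variation in the direction of the defect
  \<open>S e - l e\<close> vanishes, and this direction again lies in the subspace.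
\<close>

lemma rayleigh_maximum_eigenvector:
  fixes S :: "'a::euclidean_space \<Rightarrow> 'a"
  assumes lin: "linear S" and sub: "subspace U" and inv: "\<And>u. u \<in> U \<Longrightarrow> S u \<in> U"
    and adj: "\<And>u v. u \<in> U \<Longrightarrow> v \<in> U \<Longrightarrow> S u \<bullet> v = u \<bullet> S v"
    and nz: "U \<noteq> {0}"
  obtains e l where "e \<in> U" "e \<noteq> 0" "S e = l *\<^sub>R e" "\<And>u. u \<in> U \<Longrightarrow> u \<bullet> S u \<le> l * (u \<bullet> u)"
proof -
  interpret S: linear S by (rule lin)
  let ?K = "sphere 0 1 \<inter> U"
  obtain u where u: "u \<in> U" "u \<noteq> 0"
    using nz subspace_0[OF sub] by auto
  have "u /\<^sub>R norm u \<in> ?K"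
    using u subspace_scale[OF sub] by simp
  moreover have "compact ?K"
    using closed_subspace[OF sub] by (intro compact_Int_closed) auto
  moreover have "continuous_on ?K (\<lambda>u. u \<bullet> S u)"
    by (intro continuous_on_inner continuous_on_id linear_continuous_on)
      (simp add: lin linear_conv_bounded_linear[symmetric])
  ultimately obtain e where e: "e \<in> ?K" and max: "\<And>y. y \<in> ?K \<Longrightarrow> y \<bullet> S y \<le> e \<bullet> S e"
    using continuous_attains_sup[of ?K "\<lambda>u. u \<bullet> S u"] by blast
  define l where "l = e \<bullet> S e"
  have ee: "e \<bullet> e = 1" using e by (simp add: norm_eq_1[symmetric])
  have eU: "e \<in> U" using e by simp
  have bound: "v \<bullet> S v \<le> l * (v \<bullet> v)" if v: "v \<in> U" for v
  proof (cases "v = 0")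
    case False
    have "v /\<^sub>R norm v \<in> ?K"
      using v False subspace_scale[OF sub] by simp
    then have "(v /\<^sub>R norm v) \<bullet> S (v /\<^sub>R norm v) \<le> l"
      using max l_def by blast
    then have "(v \<bullet> S v) / (v \<bullet> v) \<le> l"
      by (simp add: S.scaleR power2_norm_eq_inner[symmetric] power2_eq_square field_simps)
    then show ?thesis
      using False by (simp add: field_simps)
  qed (simp add: S.zero)
  \<comment> \<open>The quadratic \<open>s \<mapsto> l |e + s w|\<^sup>2 - (e + s w) \<bullet> S (e + s w)\<close> is nonnegative and vanishes
    at \<open>s = 0\<close>, so its linear coefficient, a multiple of \<open>|w|\<^sup>2\<close>, is zero.\<close>
  define w where "w = S e - l *\<^sub>R e"
  have wU: "w \<in> U"
    unfolding w_def using eU inv by (intro subspace_diff[OF sub] subspace_scale[OF sub])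
  define k where "k = l * (w \<bullet> w) - w \<bullet> S w"
  have quad: "2 * s * (w \<bullet> w) \<le> s\<^sup>2 * k" for s
  proof -
    have "(e + s *\<^sub>R w) \<bullet> S (e + s *\<^sub>R w) \<le> l * ((e + s *\<^sub>R w) \<bullet> (e + s *\<^sub>R w))"
      using eU wU by (intro bound subspace_add[OF sub] subspace_scale[OF sub])
    moreover have "e \<bullet> S w = w \<bullet> S e"
      using adj[OF eU wU] by (simp add: inner_commute)
    ultimately have "l + 2 * s * (w \<bullet> S e) + s\<^sup>2 * (w \<bullet> S w)
        \<le> l * (1 + 2 * s * (w \<bullet> e) + s\<^sup>2 * (w \<bullet> w))"
      by (simp add: S.add S.scaleR inner_add_left inner_add_right ee l_def[symmetric]
          power2_eq_square algebra_simps inner_commute)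
    moreover have "w \<bullet> w = w \<bullet> S e - l * (w \<bullet> e)"
      by (metis w_def inner_diff_right inner_scaleR_right)
    then have "2 * s * (w \<bullet> w) = 2 * s * (w \<bullet> S e) - 2 * s * (l * (w \<bullet> e))"
      by (simp add: right_diff_distrib)
    ultimately show ?thesis
      by (simp add: k_def algebra_simps)
  qed
  have "w \<bullet> w = 0"
  proof (rule ccontr)
    assume "w \<bullet> w \<noteq> 0"
    then have pos: "w \<bullet> w > 0" by (simp add: less_le)
    define s where "s = (w \<bullet> w) / (\<bar>k\<bar> + 1)"
    have s: "s > 0" using pos by (simp add: s_def add_pos_nonneg)
    have "2 * (w \<bullet> w) \<le> s * k"
      using quad[of s] s by (simp add: power2_eq_square mult.assoc)
    also have "\<dots> \<le> s * (\<bar>k\<bar> + 1)"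
      using s by (intro mult_left_mono) auto
    also have "\<dots> = w \<bullet> w"
      by (simp add: s_def add_nonneg_eq_0_iff)
    finally show False using pos by simp
  qed
  then have "S e = l *\<^sub>R e" by (simp add: w_def)
  with eU ee bound show thesis by (intro that[of e l]) auto
qed

corollary rayleigh_minimum_eigenvector:
  fixes S :: "'a::euclidean_space \<Rightarrow> 'a"
  assumes lin: "linear S" and sub: "subspace U" and inv: "\<And>u. u \<in> U \<Longrightarrow> S u \<in> U"
    and adj: "\<And>u v. u \<in> U \<Longrightarrow> v \<in> U \<Longrightarrow> S u \<bullet> v = u \<bullet> S v"
    and nz: "U \<noteq> {0}"
  obtains e l where "e \<in> U" "e \<noteq> 0" "S e = l *\<^sub>R e" "\<And>u. u \<in> U \<Longrightarrow> u \<bullet> S u \<ge> l * (u \<bullet> u)"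
proof -
  have "linear (\<lambda>u. - S u)" using lin by (rule linear_compose_neg)
  then obtain e l where "e \<in> U" "e \<noteq> 0" "- S e = l *\<^sub>R e"
    and "\<And>u. u \<in> U \<Longrightarrow> u \<bullet> - S u \<le> l * (u \<bullet> u)"
    using rayleigh_maximum_eigenvector[of "\<lambda>u. - S u" U] sub inv adj nz
    by (auto simp: subspace_neg)
  then show thesis
    by (intro that[of e "- l"]) (auto simp: minus_equation_iff[of "S e"] minus_le_iff)
qed

text \<open>
  The next lemmas identify \<^const>\<open>closest_point\<close> on a subspace with the orthogonal projection, so
  that \<^const>\<open>restricted\<close> is linear and represents the quadratic form of \<open>A\<close> on the subspace.
\<close>

lemma closest_point_subspace_orthogonal:
  fixes T :: "'a::euclidean_space set"
  assumes sub: "subspace T" and v: "v \<in> T"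
  shows "(y - closest_point T y) \<bullet> v = 0"
proof -
  note cl = closed_subspace[OF sub] and cv = subspace_imp_convex[OF sub]
  have cp: "closest_point T y \<in> T"
    using cl subspace_0[OF sub] by (intro closest_point_in_set) auto
  have "(y - closest_point T y) \<bullet> u \<le> 0" if "u \<in> T" for u
    using closest_point_dot[OF cv cl, of "closest_point T y + u" y] subspace_add[OF sub cp that]
    by simp
  from this[OF v] this[OF subspace_neg[OF sub v]] show ?thesis by simp
qed

lemma closest_point_subspace_mem:
  fixes T :: "'a::euclidean_space set"
  assumes "subspace T"
  shows "closest_point T y \<in> T"
  using closed_subspace[OF assms] subspace_0[OF assms] by (intro closest_point_in_set) auto

lemma closest_point_subspace_eqI:
  fixes T :: "'a::euclidean_space set"
  assumes sub: "subspace T" and p: "p \<in> T" and orth: "\<And>v. v \<in> T \<Longrightarrow> (y - p) \<bullet> v = 0"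
  shows "closest_point T y = p"
proof -
  let ?d = "closest_point T y - p"
  have d: "?d \<in> T" by (intro subspace_diff[OF sub] closest_point_subspace_mem sub p)
  have "?d \<bullet> ?d = (y - p) \<bullet> ?d - (y - closest_point T y) \<bullet> ?d"
    by (simp add: algebra_simps inner_diff_left)
  also have "\<dots> = 0"
    using orth[OF d] closest_point_subspace_orthogonal[OF sub d] by simp
  finally show ?thesis by simp
qed

lemma linear_restricted:
  assumes sub: "subspace T"
  shows "linear (restricted A T)"
proof (rule linearI)
  note mem = closest_point_subspace_mem[OF sub] and orth = closest_point_subspace_orthogonal[OF sub]
  show "restricted A T (x + y) = restricted A T x + restricted A T y" for x y
    unfolding restricted_def using orth[where y = "A *v x"] orth[where y = "A *v y"]
    by (intro closest_point_subspace_eqI sub subspace_add mem)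
      (simp add: matrix_vector_right_distrib algebra_simps inner_diff_left inner_add_left)
  show "restricted A T (c *\<^sub>R x) = c *\<^sub>R restricted A T x" for c x
    unfolding restricted_def using orth[where y = "A *v x"]
    by (intro closest_point_subspace_eqI sub subspace_scale mem)
      (simp add: matrix_vector_mult_scaleR inner_diff_left)
qed

lemma restricted_inner:
  assumes "subspace T" and "v \<in> T"
  shows "restricted A T x \<bullet> v = (A *v x) \<bullet> v"
  using closest_point_subspace_orthogonal[OF assms, of "A *v x"]
  by (simp add: restricted_def inner_diff_left)

text \<open>
  Sylvester's splitting of \<open>T\<close> into mutually orthogonal parts: \<open>N\<close>, where the form is negative
  definite, and \<open>W\<close>, where it is nonnegative.  The orthogonality is recorded by the last two
  clauses, which say that each part contains the orthogonal complement of the other in \<open>T\<close>.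
\<close>

definition inertia_splitting ::
  "real^'n^'n \<Rightarrow> (real^'n) set \<Rightarrow> (real^'n) set \<Rightarrow> (real^'n) set \<Rightarrow> bool" where
  "inertia_splitting A T N W \<longleftrightarrow>
     subspace N \<and> subspace W \<and> N \<subseteq> T \<and> W \<subseteq> T \<and>
     dim N = num_neg_eigenvalues A T \<and> dim N + dim W = dim T \<and>
     (\<forall>v\<in>N. v \<noteq> 0 \<longrightarrow> v \<bullet> (A *v v) < 0) \<and>
     (\<forall>v\<in>W. v \<bullet> (A *v v) \<ge> 0) \<and>
     (nonsingular_on A T \<longrightarrow> (\<forall>v\<in>W. v \<noteq> 0 \<longrightarrow> v \<bullet> (A *v v) > 0)) \<and>
     (\<forall>v\<in>T. (\<forall>w\<in>W. w \<bullet> v = 0) \<longrightarrow> v \<in> N) \<and>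
     (\<forall>v\<in>T. (\<forall>w\<in>N. w \<bullet> v = 0) \<longrightarrow> v \<in> W)"

text \<open>
  Take for \<open>N\<close> the span of the eigenspaces to negative eigenvalues and for \<open>W\<close> its orthogonal
  complement in \<open>T\<close>.  Eigenspaces to distinct eigenvalues are orthogonal, which gives the dimension
  of \<open>N\<close>.  Both parts are invariant, so the maximum of the Rayleigh quotient on \<open>N\<close> and its minimum
  on \<open>W\<close> are attained at eigenvectors; a nonnegative maximum or a negative minimum would give an
  eigenvector orthogonal to itself.  A zero minimum on \<open>W\<close> would give a kernel vector, so a
  nonsingular restriction is positive definite on \<open>W\<close>.
\<close>

lemma inertia_splitting_exists:
  fixes A :: "real^'n^'n"
  assumes sub: "subspace T" and sym: "\<And>u v. (A *v u) \<bullet> v = u \<bullet> (A *v v)"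
  obtains N W where "inertia_splitting A T N W"
proof -
  let ?S = "restricted A T" and ?E = "eigenspace_on A T"
  define L where "L = {l. l \<in> eigenvalues_on A T \<and> l < 0}"
  define N where "N = span (\<Union>l\<in>L. ?E l)"
  define W where "W = {v \<in> T. \<forall>w\<in>N. w \<bullet> v = 0}"
  note lin = linear_restricted[OF sub, of A]
  interpret S: linear ?S by (rule lin)
  have ST: "?S v \<in> T" for v
    by (simp add: restricted_def closest_point_subspace_mem[OF sub])
  have adj: "?S u \<bullet> v = u \<bullet> ?S v" if "u \<in> T" "v \<in> T" for u v
    using restricted_inner[OF sub that(2), of A u] restricted_inner[OF sub that(1), of A v] sym
    by (simp add: inner_commute)
  have form: "v \<bullet> ?S v = v \<bullet> (A *v v)" if "v \<in> T" for v
    using restricted_inner[OF sub that, of A v] by (simp add: inner_commute)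
  have orthE: "u \<bullet> v = 0" if "u \<in> ?E l" "v \<in> ?E m" "l \<noteq> m" for u v l m
  proof -
    have "l * (u \<bullet> v) = m * (u \<bullet> v)"
      using that adj[of u v] by (simp add: eigenspace_on_def)
    with that(3) show ?thesis by simp
  qed
  have "finite L"
  proof -
    have "\<forall>l\<in>L. \<exists>v. v \<in> ?E l \<and> v \<noteq> 0" by (auto simp: L_def eigenvalues_on_def)
    then obtain v where v: "\<And>l. l \<in> L \<Longrightarrow> v l \<in> ?E l \<and> v l \<noteq> 0" by metis
    have inj: "inj_on v L"
      using v orthE by (intro inj_onI) (metis inner_eq_zero_iff)
    have "pairwise orthogonal (v ` L)"
      unfolding pairwise_image by (auto simp: pairwise_def orthogonal_def dest: v intro: orthE)
    then have "independent (v ` L)"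
      using v by (intro pairwise_orthogonal_independent) auto
    then show ?thesis
      using inj finite_imageD independent_imp_finite by blast
  qed
  have "dim (\<Union>l\<in>M. ?E l) = (\<Sum>l\<in>M. dim (?E l))" if "finite M" for M
    using that
  proof (induction M)
    case (insert l M)
    have "dim (?E l \<union> (\<Union>m\<in>M. ?E m)) = dim (?E l) + dim (\<Union>m\<in>M. ?E m)"
      using insert.hyps orthE by (intro dim_orthogonal_sum) auto
    with insert show ?case by simp
  qed simp
  from this[OF \<open>finite L\<close>] have dimN: "dim N = num_neg_eigenvalues A T"
    by (simp add: N_def num_neg_eigenvalues_def L_def)
  have subN: "subspace N" by (simp add: N_def)
  have NT: "N \<subseteq> T"
    unfolding N_def by (intro span_minimal sub) (auto simp: eigenspace_on_def)
  have SN: "?S v \<in> N" if "v \<in> N" for v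
  proof -
    have "?S ` (\<Union>l\<in>L. ?E l) \<subseteq> N"
    proof clarify
      fix l u assume "l \<in> L" "u \<in> ?E l"
      moreover from this have "u \<in> N" unfolding N_def by (auto intro: span_base)
      ultimately show "?S u \<in> N" by (simp add: eigenspace_on_def subspace_scale[OF subN])
    qed
    then have "?S ` N \<subseteq> N"
      unfolding N_def by (metis lin linear_span_image span_minimal subspace_span)
    with that show ?thesis by blast
  qed
  have subW: "subspace W"
    unfolding W_def subspace_def using sub
    by (auto simp: inner_add_right subspace_0 subspace_add subspace_scale)
  have WT: "W \<subseteq> T" by (auto simp: W_def)
  have SW: "?S v \<in> W" if "v \<in> W" for v
  proof -
    have "w \<bullet> ?S v = 0" if "w \<in> N" for w
      using adj[of w v] SN[OF that] that NT \<open>v \<in> W\<close> by (auto simp: W_def)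
    with ST show ?thesis by (simp add: W_def)
  qed
  have decomp: "\<exists>a b. a \<in> N \<and> b \<in> W \<and> v = a + b" if "v \<in> T" for v
  proof -
    obtain a b where a: "a \<in> span N" and b: "\<And>w. w \<in> span N \<Longrightarrow> orthogonal b w" and ab: "v = a + b"
      using orthogonal_subspace_decomp_exists[of N v] by blast
    have a: "a \<in> N" using a subN by (metis span_eq_iff)
    have "b = v - a" using ab by simp
    then have "b \<in> T" using that a NT by (auto intro: subspace_diff[OF sub])
    then have "b \<in> W" using b by (auto simp: W_def orthogonal_def inner_commute span_base)
    with a ab show ?thesis by blast
  qed
  have NW: "n \<bullet> w = 0" if "n \<in> N" "w \<in> W" for n w
    using that by (simp add: W_def)
  have "span (N \<union> W) = T"
  proof
    show "span (N \<union> W) \<subseteq> T" using NT WT by (intro span_minimal sub) auto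
    show "T \<subseteq> span (N \<union> W)" using decomp by (blast intro: span_add span_base)
  qed
  then have dimT: "dim N + dim W = dim T"
    using dim_orthogonal_sum[of N W] NW by (metis dim_span)
  \<comment> \<open>An eigenvector in \<open>W\<close> to a negative eigenvalue would also lie in \<open>N\<close>.\<close>
  have eigW: "l \<ge> 0" if "e \<in> W" "e \<noteq> 0" "?S e = l *\<^sub>R e" for e l
  proof (rule ccontr)
    assume "\<not> l \<ge> 0"
    then have "e \<in> N"
      using that WT unfolding N_def
      by (intro span_base) (auto simp: L_def eigenvalues_on_def eigenspace_on_def)
    with NW[OF this that(1)] that show False by simp
  qed
  \<comment> \<open>An eigenvector to a nonnegative eigenvalue is orthogonal to all eigenspaces that span \<open>N\<close>.\<close>
  have eigN: "l < 0" if e: "e \<in> N" "e \<noteq> 0" "?S e = l *\<^sub>R e" for e l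
  proof (rule ccontr)
    assume l: "\<not> l < 0"
    have "e \<in> ?E l" using e NT by (auto simp: eigenspace_on_def)
    then have "e \<bullet> u = 0" if "u \<in> (\<Union>l\<in>L. ?E l)" for u
      using that orthE[OF \<open>e \<in> ?E l\<close>] l unfolding L_def by blast
    then have "N \<subseteq> {u. e \<bullet> u = 0}"
      unfolding N_def by (intro span_minimal subspace_hyperplane) auto
    with e show False by auto
  qed
  have neg: "v \<bullet> (A *v v) < 0" if "v \<in> N" "v \<noteq> 0" for v
  proof -
    have "N \<noteq> {0}" using that by auto
    then obtain e l where e: "e \<in> N" "e \<noteq> 0" "?S e = l *\<^sub>R e"
      and max: "\<And>u. u \<in> N \<Longrightarrow> u \<bullet> ?S u \<le> l * (u \<bullet> u)"
      using rayleigh_maximum_eigenvector[OF lin subN SN] adj NT by (metis subsetD)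
    have "l * (v \<bullet> v) < 0" using eigN[OF e] that by (simp add: mult_neg_pos)
    moreover have "v \<in> T" using that NT by blast
    ultimately show ?thesis using max[OF that(1)] form by simp
  qed
  have nonneg: "\<exists>l\<ge>0. v \<bullet> (A *v v) \<ge> l * (v \<bullet> v) \<and> (nonsingular_on A T \<longrightarrow> l > 0)"
    if v: "v \<in> W" "v \<noteq> 0" for v
  proof -
    have "W \<noteq> {0}" using that by auto
    then obtain e l where e: "e \<in> W" "e \<noteq> 0" "?S e = l *\<^sub>R e"
      and min: "\<And>u. u \<in> W \<Longrightarrow> u \<bullet> ?S u \<ge> l * (u \<bullet> u)"
      using rayleigh_minimum_eigenvector[OF lin subW SW] adj WT by (metis subsetD)
    have "l \<noteq> 0" if "nonsingular_on A T"
    proof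
      assume "l = 0"
      then have "?S e = ?S 0" using e by (simp add: S.zero)
      then show False
        using that e WT subspace_0[OF sub]
        unfolding nonsingular_on_def bij_betw_def by (metis inj_onD subsetD)
    qed
    moreover have "l * (v \<bullet> v) \<le> v \<bullet> (A *v v)"
      using min[OF v(1)] form[of v] v WT by auto
    ultimately show ?thesis using eigW[OF e] by (auto simp: less_le)
  qed
  have semidef: "v \<bullet> (A *v v) \<ge> 0" if v: "v \<in> W" for v
  proof (cases "v = 0")
    case False
    then obtain l where "l \<ge> 0" "v \<bullet> (A *v v) \<ge> l * (v \<bullet> v)"
      using nonneg[OF v False] by blast
    moreover from this have "l * (v \<bullet> v) \<ge> 0" by simp
    ultimately show ?thesis by linarith
  qed simp
  have def: "v \<bullet> (A *v v) > 0" if ns: "nonsingular_on A T" and v: "v \<in> W" "v \<noteq> 0" for v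
  proof -
    obtain l where "l > 0" "v \<bullet> (A *v v) \<ge> l * (v \<bullet> v)"
      using nonneg[OF v] ns by blast
    moreover from this have "l * (v \<bullet> v) > 0" using v by simp
    ultimately show ?thesis by linarith
  qed
  have perpW: "v \<in> N" if v: "v \<in> T" and orth: "\<forall>w\<in>W. w \<bullet> v = 0" for v
  proof -
    obtain a b where ab: "a \<in> N" "b \<in> W" "v = a + b" using decomp[OF v] by blast
    have "b \<bullet> b = b \<bullet> v - a \<bullet> b" using ab by (simp add: inner_add_right inner_commute)
    also have "\<dots> = 0" using orth NW[OF ab(1,2)] ab(2) by simp
    finally show ?thesis using ab by simp
  qed
  have perpN: "v \<in> W" if "v \<in> T" "\<forall>w\<in>N. w \<bullet> v = 0" for v
    using that by (simp add: W_def)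
  have "inertia_splitting A T N W"
    unfolding inertia_splitting_def
    by (intro conjI subN subW NT WT dimN dimT) (use neg semidef def perpW perpN in blast)+
  then show thesis by (rule that)
qed

lemma dim_orthogonal_complement:
  fixes B :: "'a::euclidean_space set"
  shows "dim {v. \<forall>b\<in>B. b \<bullet> v = 0} + dim B = DIM('a)"
proof -
  have "{v. \<forall>b\<in>B. b \<bullet> v = 0} = {v \<in> UNIV. \<forall>b\<in>span B. orthogonal b v}"
  proof (intro set_eqI iffI)
    fix v assume "v \<in> {v. \<forall>b\<in>B. b \<bullet> v = 0}"
    then have "span B \<subseteq> {b. v \<bullet> b = 0}"
      by (intro span_minimal subspace_hyperplane) (auto simp: inner_commute)
    then show "v \<in> {v \<in> UNIV. \<forall>b\<in>span B. orthogonal b v}"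
      by (auto simp: orthogonal_def inner_commute)
  qed (auto simp: orthogonal_def span_base)
  then show ?thesis
    using dim_subspace_orthogonal_to_vectors[of "span B" UNIV] by (simp add: dim_span)
qed

lemma subspace_orthogonal_complement:
  fixes B :: "'a::real_inner set"
  shows "subspace {v. \<forall>b\<in>B. b \<bullet> v = 0}"
  by (auto simp: subspace_def inner_add_right)

lemma dim_independent_family:
  fixes v :: "'i \<Rightarrow> 'a::euclidean_space"
  assumes "independent_family v I"
  shows "dim (v ` I) = card I"
  using assms by (simp add: independent_family_def dim_eq_card_independent card_image)

lemma dim_trivial_intersection:
  fixes U V :: "'a::euclidean_space set"
  assumes "subspace U" "subspace V" "subspace T" "U \<subseteq> T" "V \<subseteq> T" "U \<inter> V \<subseteq> {0}"
  shows "dim U + dim V \<le> dim T"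
proof -
  have "dim {x + y |x y. x \<in> U \<and> y \<in> V} + dim (U \<inter> V) = dim U + dim V"
    using assms by (intro dim_sums_Int)
  moreover have "dim {x + y |x y. x \<in> U \<and> y \<in> V} \<le> dim T"
    using assms by (intro dim_subset) (auto intro: subspace_add)
  moreover have "dim (U \<inter> V) = 0"
    using assms(6) by (simp add: dim_eq_0)
  ultimately show ?thesis by simp
qed

section \<open>Gradients and Hessians\<close>

lemma grad_eqI:
  assumes "(\<phi> has_derivative (\<lambda>h. G \<bullet> h)) (at x)"
  shows "grad \<phi> x = G"
  by (simp add: grad_def vec_eq_iff inner_axis frechet_derivative_at[OF assms, symmetric])

lemma has_derivative_grad:
  assumes "\<phi> differentiable (at x)"
  shows "(\<phi> has_derivative (\<lambda>h. grad \<phi> x \<bullet> h)) (at x)"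
proof -
  let ?D = "frechet_derivative \<phi> (at x)"
  interpret D: linear ?D by (rule linear_frechet_derivative[OF assms])
  have "?D h = grad \<phi> x \<bullet> h" for h
  proof -
    have "?D h = ?D (\<Sum>i\<in>UNIV. h $ i *\<^sub>R axis i 1)"
      by (simp add: basis_expansion flip: scalar_mult_eq_scaleR)
    also have "\<dots> = grad \<phi> x \<bullet> h"
      by (simp add: D.sum D.scaleR grad_def inner_vec_def mult.commute)
    finally show ?thesis .
  qed
  then have "?D = (\<lambda>h. grad \<phi> x \<bullet> h)" by blast
  with assms show ?thesis by (simp add: frechet_derivative_works)
qed

lemma hessian_apply:
  assumes "(grad \<phi> has_derivative D) (at x)"
  shows "hessian \<phi> x *v h = D h"
proof -
  have "grad \<phi> differentiable (at x)" using assms by (rule differentiableI)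
  then have "(grad \<phi> has_derivative (*v) (hessian \<phi> x)) (at x)"
    by (simp add: jacobian_works hessian_def)
  then show ?thesis using assms has_derivative_unique by metis
qed

lemma C2_has_derivative:
  assumes "C2 \<phi>"
  shows "(\<phi> has_derivative (\<lambda>h. grad \<phi> x \<bullet> h)) (at x)"
  using assms by (intro has_derivative_grad) (simp add: C2_def)

lemma C2_grad_has_derivative:
  assumes "C2 \<phi>"
  shows "(grad \<phi> has_derivative (*v) (hessian \<phi> x)) (at x)"
  using assms by (simp add: C2_def jacobian_works hessian_def)

lemma C2_has_derivative_along_line:
  assumes "C2 \<phi>"
  shows "((\<lambda>a. \<phi> (p + a *\<^sub>R u)) has_real_derivative grad \<phi> (p + a *\<^sub>R u) \<bullet> u) (at a)"
    and "((\<lambda>a. grad \<phi> (p + a *\<^sub>R u) \<bullet> v) has_real_derivative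
      (hessian \<phi> (p + a *\<^sub>R u) *v u) \<bullet> v) (at a)"
proof -
  have line: "((\<lambda>a. p + a *\<^sub>R u) has_derivative (\<lambda>h. h *\<^sub>R u)) (at a)"
    by (auto intro!: derivative_eq_intros)
  from has_derivative_compose[OF line C2_has_derivative[OF assms]]
  show "((\<lambda>a. \<phi> (p + a *\<^sub>R u)) has_real_derivative grad \<phi> (p + a *\<^sub>R u) \<bullet> u) (at a)"
    by (simp add: has_field_derivative_def mult_commute_abs)
  from has_derivative_inner_left[OF has_derivative_compose[OF line C2_grad_has_derivative[OF assms]]]
  show "((\<lambda>a. grad \<phi> (p + a *\<^sub>R u) \<bullet> v) has_real_derivative
      (hessian \<phi> (p + a *\<^sub>R u) *v u) \<bullet> v) (at a)"
    by (simp add: has_field_derivative_def matrix_vector_mult_scaleR mult_commute_abs)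
qed

text \<open>
  Applying the mean value theorem first in direction \<open>u\<close> and then in direction \<open>v\<close> expresses the
  second difference, which is symmetric in \<open>u\<close> and \<open>v\<close>, by the Hessian near \<open>x\<close>.
\<close>

lemma second_difference_mean_value:
  assumes C2: "C2 \<phi>" and s: "s > 0"
  shows "\<exists>a b. 0 < a \<and> a < s \<and> 0 < b \<and> b < s \<and>
    \<phi> (x + s *\<^sub>R u + s *\<^sub>R v) - \<phi> (x + s *\<^sub>R u) - \<phi> (x + s *\<^sub>R v) + \<phi> x
      = s\<^sup>2 * ((hessian \<phi> (x + a *\<^sub>R u + b *\<^sub>R v) *v v) \<bullet> u)"
proof -
  have "((\<lambda>a. \<phi> ((x + s *\<^sub>R v) + a *\<^sub>R u) - \<phi> (x + a *\<^sub>R u)) has_real_derivative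
      (grad \<phi> ((x + s *\<^sub>R v) + a *\<^sub>R u) \<bullet> u - grad \<phi> (x + a *\<^sub>R u) \<bullet> u)) (at a)" for a
    by (rule DERIV_diff C2_has_derivative_along_line C2)+
  from MVT2[OF s this] obtain a where a: "0 < a" "a < s" and
    1: "\<phi> ((x + s *\<^sub>R v) + s *\<^sub>R u) - \<phi> (x + s *\<^sub>R u) - (\<phi> (x + s *\<^sub>R v) - \<phi> x)
      = s * (grad \<phi> ((x + s *\<^sub>R v) + a *\<^sub>R u) \<bullet> u - grad \<phi> (x + a *\<^sub>R u) \<bullet> u)"
    by auto
  have "((\<lambda>b. grad \<phi> ((x + a *\<^sub>R u) + b *\<^sub>R v) \<bullet> u) has_real_derivative
      (hessian \<phi> ((x + a *\<^sub>R u) + b *\<^sub>R v) *v v) \<bullet> u) (at b)" for b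
    by (rule C2_has_derivative_along_line C2)+
  from MVT2[OF s this] obtain b where b: "0 < b" "b < s" and
    2: "grad \<phi> ((x + a *\<^sub>R u) + s *\<^sub>R v) \<bullet> u - grad \<phi> (x + a *\<^sub>R u) \<bullet> u
      = s * ((hessian \<phi> ((x + a *\<^sub>R u) + b *\<^sub>R v) *v v) \<bullet> u)"
    by auto
  have swap: "(x + s *\<^sub>R v) + c *\<^sub>R u = x + c *\<^sub>R u + s *\<^sub>R v" for c
    by (simp add: ac_simps)
  show ?thesis
    using a b 1[unfolded swap] 2
    by (intro exI[of _ a] exI[of _ b]) (simp add: power2_eq_square)
qed

lemma tendsto_matrix_vector_mult [tendsto_intros]:
  fixes A :: "'b \<Rightarrow> real^'n^'m"
  assumes "(A \<longlongrightarrow> B) F" "(v \<longlongrightarrow> w) F"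
  shows "((\<lambda>i. A i *v v i) \<longlongrightarrow> B *v w) F"
proof -
  have "((\<lambda>i. (A i *v v i) $ k) \<longlongrightarrow> (B *v w) $ k) F" for k
    by (simp add: matrix_vector_mult_def) (intro tendsto_sum tendsto_mult tendsto_vec_nth assms)
  then show ?thesis by (rule vec_tendstoI)
qed

lemma C2_hessian_tendsto:
  assumes "C2 \<phi>" and "(y \<longlongrightarrow> x) F"
  shows "((\<lambda>i. hessian \<phi> (y i)) \<longlongrightarrow> hessian \<phi> x) F"
  using continuous_on_tendsto_compose[of UNIV "hessian \<phi>" y x F] assms by (simp add: C2_def)

lemma C2_grad_tendsto:
  assumes "C2 \<phi>" and "(y \<longlongrightarrow> x) F"
  shows "((\<lambda>i. grad \<phi> (y i)) \<longlongrightarrow> grad \<phi> x) F"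
  using isCont_tendsto_compose[OF has_derivative_continuous[OF C2_grad_has_derivative[OF assms(1)]]
      assms(2)] .

lemma C2_tendsto:
  assumes "C2 \<phi>" and "(y \<longlongrightarrow> x) F"
  shows "((\<lambda>i. \<phi> (y i)) \<longlongrightarrow> \<phi> x) F"
  using isCont_tendsto_compose[OF has_derivative_continuous[OF C2_has_derivative[OF assms(1)]]
      assms(2)] .

text \<open>
  Schwarz's theorem.  The second difference over a small square, divided by its area, tends both to
  \<open>(H v) \<bullet> u\<close> and to \<open>(H u) \<bullet> v\<close>, according to the order of the two mean value steps.
\<close>

lemma C2_hessian_symmetric:
  assumes C2: "C2 \<phi>"
  shows "(hessian \<phi> x *v u) \<bullet> v = u \<bullet> (hessian \<phi> x *v v)"
proof -
  define s :: "nat \<Rightarrow> real" where "s n = 1 / real (Suc n)" for n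
  have s: "s n > 0" for n by (simp add: s_def)
  have s0: "s \<longlonglongrightarrow> 0"
    unfolding s_def using LIMSEQ_inverse_real_of_nat by (simp add: inverse_eq_divide)
  define \<Delta> where "\<Delta> n = (\<phi> (x + s n *\<^sub>R u + s n *\<^sub>R v) - \<phi> (x + s n *\<^sub>R u)
      - \<phi> (x + s n *\<^sub>R v) + \<phi> x) / (s n)\<^sup>2" for n
  have lim: "D \<longlonglongrightarrow> (hessian \<phi> x *v w) \<bullet> z"
    if D: "\<And>n. \<exists>a b. 0 < a \<and> a < s n \<and> 0 < b \<and> b < s n \<and>
      D n = (hessian \<phi> (x + a *\<^sub>R z + b *\<^sub>R w) *v w) \<bullet> z" for D and z w
  proof -
    obtain a b where ab: "\<And>n. 0 < a n \<and> a n < s n \<and> 0 < b n \<and> b n < s n \<and>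
      D n = (hessian \<phi> (x + a n *\<^sub>R z + b n *\<^sub>R w) *v w) \<bullet> z"
      using D by metis
    have a0: "a \<longlonglongrightarrow> 0"
      by (rule tendsto_sandwich[OF _ _ tendsto_const s0]) (simp_all add: ab less_imp_le)
    have b0: "b \<longlonglongrightarrow> 0"
      by (rule tendsto_sandwich[OF _ _ tendsto_const s0]) (simp_all add: ab less_imp_le)
    have "(\<lambda>n. x + a n *\<^sub>R z + b n *\<^sub>R w) \<longlonglongrightarrow> x + 0 *\<^sub>R z + 0 *\<^sub>R w"
      by (intro tendsto_intros a0 b0)
    then have "(\<lambda>n. x + a n *\<^sub>R z + b n *\<^sub>R w) \<longlonglongrightarrow> x" by simp
    then have "(\<lambda>n. (hessian \<phi> (x + a n *\<^sub>R z + b n *\<^sub>R w) *v w) \<bullet> z) \<longlonglongrightarrow> (hessian \<phi> x *v w) \<bullet> z"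
      by (intro tendsto_intros C2_hessian_tendsto[OF C2])
    moreover have "D = (\<lambda>n. (hessian \<phi> (x + a n *\<^sub>R z + b n *\<^sub>R w) *v w) \<bullet> z)"
      using ab by auto
    ultimately show ?thesis by simp
  qed
  have "\<Delta> \<longlonglongrightarrow> (hessian \<phi> x *v v) \<bullet> u"
  proof (rule lim)
    fix n
    show "\<exists>a b. 0 < a \<and> a < s n \<and> 0 < b \<and> b < s n \<and>
        \<Delta> n = (hessian \<phi> (x + a *\<^sub>R u + b *\<^sub>R v) *v v) \<bullet> u"
      using second_difference_mean_value[OF C2 s[of n], of x u v] s[of n]
      unfolding \<Delta>_def by (elim exE conjE, intro exI conjI) simp_all
  qed
  moreover have "\<Delta> \<longlonglongrightarrow> (hessian \<phi> x *v u) \<bullet> v"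
  proof (rule lim)
    fix n
    have eq: "\<Delta> n = (\<phi> (x + s n *\<^sub>R v + s n *\<^sub>R u) - \<phi> (x + s n *\<^sub>R v)
        - \<phi> (x + s n *\<^sub>R u) + \<phi> x) / (s n)\<^sup>2"
      by (simp add: \<Delta>_def add.commute add.left_commute)
    show "\<exists>a b. 0 < a \<and> a < s n \<and> 0 < b \<and> b < s n \<and>
        \<Delta> n = (hessian \<phi> (x + a *\<^sub>R v + b *\<^sub>R u) *v u) \<bullet> v"
      using second_difference_mean_value[OF C2 s[of n], of x v u] s[of n]
      unfolding eq by (elim exE conjE, intro exI conjI) simp_all
  qed
  ultimately have "(hessian \<phi> x *v v) \<bullet> u = (hessian \<phi> x *v u) \<bullet> v" by (rule LIMSEQ_unique)
  then show ?thesis by (simp add: inner_commute)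
qed

lemma hessian_linear_combination:
  fixes F1 F2 :: "real^'n \<Rightarrow> real^'k"
  assumes f: "C2 f" and F1: "C2_vec F1" and F2: "C2_vec F2"
  shows "hessian (\<lambda>y. f y - (\<Sum>j\<in>UNIV. m1 j * F1 y $ j + m2 j * F2 y $ j)) x *v h
    = hessian f x *v h - (\<Sum>j\<in>UNIV. m1 j *\<^sub>R (hessian (\<lambda>y. F1 y $ j) x *v h)
        + m2 j *\<^sub>R (hessian (\<lambda>y. F2 y $ j) x *v h))"
proof -
  have F: "C2 (\<lambda>y. F1 y $ j)" "C2 (\<lambda>y. F2 y $ j)" for j
    using F1 F2 by (auto simp: C2_vec_def)
  note d = C2_has_derivative[OF f] F[THEN C2_has_derivative]
    and d2 = C2_grad_has_derivative[OF f] F[THEN C2_grad_has_derivative]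
  have "grad (\<lambda>y. f y - (\<Sum>j\<in>UNIV. m1 j * F1 y $ j + m2 j * F2 y $ j))
     = (\<lambda>y. grad f y - (\<Sum>j\<in>UNIV. m1 j *\<^sub>R grad (\<lambda>y. F1 y $ j) y + m2 j *\<^sub>R grad (\<lambda>y. F2 y $ j) y))"
    by (intro ext grad_eqI, rule has_derivative_eq_rhs,
        (rule has_derivative_diff has_derivative_add has_derivative_sum has_derivative_mult
          has_derivative_const d)+)
      (simp add: inner_diff_left inner_sum_left inner_add_left)
  note grad = this
  have "((\<lambda>y. grad f y - (\<Sum>j\<in>UNIV. m1 j *\<^sub>R grad (\<lambda>y. F1 y $ j) y + m2 j *\<^sub>R grad (\<lambda>y. F2 y $ j) y))
     has_derivative (\<lambda>h. hessian f x *v h - (\<Sum>j\<in>UNIV. m1 j *\<^sub>R (hessian (\<lambda>y. F1 y $ j) x *v h)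
        + m2 j *\<^sub>R (hessian (\<lambda>y. F2 y $ j) x *v h)))) (at x)"
    by (intro has_derivative_diff has_derivative_add has_derivative_sum has_derivative_scaleR_right d2)
  from hessian_apply[OF this[folded grad]] show ?thesis .
qed

text \<open>
  Differentiating the products \<open>F1 * F2\<close> twice produces, besides the Hessians of the factors, the
  mixed terms in the two gradients.  These mixed terms decide the index in the limit.
\<close>

lemma hessian_lagrangian_S:
  fixes F1 F2 :: "real^'n \<Rightarrow> real^'k"
  assumes f: "C2 f" and F1: "C2_vec F1" and F2: "C2_vec F2"
  shows "hessian (lagrangian_S f F1 F2 t \<eta>) x *v h
    = hessian f x *v h + (\<Sum>j\<in>UNIV. \<eta> j *\<^sub>R
        (F2 x $ j *\<^sub>R (hessian (\<lambda>y. F1 y $ j) x *v h)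
          + (grad (\<lambda>y. F2 y $ j) x \<bullet> h) *\<^sub>R grad (\<lambda>y. F1 y $ j) x
         + (F1 x $ j *\<^sub>R (hessian (\<lambda>y. F2 y $ j) x *v h)
          + (grad (\<lambda>y. F1 y $ j) x \<bullet> h) *\<^sub>R grad (\<lambda>y. F2 y $ j) x)))"
proof -
  have F: "C2 (\<lambda>y. F1 y $ j)" "C2 (\<lambda>y. F2 y $ j)" for j
    using F1 F2 by (auto simp: C2_vec_def)
  note d = C2_has_derivative[OF f] F[THEN C2_has_derivative]
    and d2 = C2_grad_has_derivative[OF f] F[THEN C2_grad_has_derivative]
  have eq: "lagrangian_S f F1 F2 t \<eta> = (\<lambda>y. f y + (\<Sum>j\<in>UNIV. \<eta> j * (F1 y $ j * F2 y $ j - t)))"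
    by (simp add: lagrangian_S_def fun_eq_iff right_diff_distrib sum_subtractf)
  have "grad (lagrangian_S f F1 F2 t \<eta>)
     = (\<lambda>y. grad f y + (\<Sum>j\<in>UNIV. \<eta> j *\<^sub>R constraint_grad_S F1 F2 y j))"
    unfolding eq
    by (intro ext grad_eqI, rule has_derivative_eq_rhs,
        (rule has_derivative_diff has_derivative_add has_derivative_sum has_derivative_mult
          has_derivative_const d)+)
      (simp add: inner_sum_left inner_add_left constraint_grad_S_def algebra_simps)
  note grad = this
  have "((\<lambda>y. grad f y + (\<Sum>j\<in>UNIV. \<eta> j *\<^sub>R constraint_grad_S F1 F2 y j))
     has_derivative (\<lambda>h. hessian f x *v h + (\<Sum>j\<in>UNIV. \<eta> j *\<^sub>R
        (F2 x $ j *\<^sub>R (hessian (\<lambda>y. F1 y $ j) x *v h)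
          + (grad (\<lambda>y. F2 y $ j) x \<bullet> h) *\<^sub>R grad (\<lambda>y. F1 y $ j) x
         + (F1 x $ j *\<^sub>R (hessian (\<lambda>y. F2 y $ j) x *v h)
          + (grad (\<lambda>y. F1 y $ j) x \<bullet> h) *\<^sub>R grad (\<lambda>y. F2 y $ j) x))))) (at x)"
    unfolding constraint_grad_S_def
    by (intro has_derivative_add has_derivative_sum has_derivative_scaleR_right
        has_derivative_scaleR d d2)
  from hessian_apply[OF this[folded grad]] show ?thesis .
qed

section \<open>Convergence of coefficients and accumulation points\<close>

lemma tendsto_matrixI:
  fixes A :: "'i \<Rightarrow> real^'n^'m"
  assumes "\<And>v. ((\<lambda>i. A i *v v) \<longlongrightarrow> B *v v) F"
  shows "(A \<longlongrightarrow> B) F"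
proof (intro vec_tendstoI)
  fix k l
  have "C $ k $ l = (C *v axis l 1) $ k" for C :: "real^'n^'m"
    by (simp add: matrix_vector_mul_component inner_axis)
  then show "((\<lambda>i. A i $ k $ l) \<longlongrightarrow> B $ k $ l) F"
    using tendsto_vec_nth[OF assms] by simp
qed

text \<open>
  Linear independence is stable: the coefficients of the limit family are bounded by the norm of
  the combination (dual functionals), and for a nearby family the error in this bound is absorbed
  into the left-hand side.  So convergent combinations have convergent coefficients.
\<close>

lemma independent_coefficients_tendsto:
  fixes v :: "'k \<Rightarrow> 'a::euclidean_space"
  assumes fin: "finite K" and ind: "independent_family v K"
    and w: "\<And>k. k \<in> K \<Longrightarrow> ((\<lambda>i. w i k) \<longlongrightarrow> v k) F"
    and sum: "((\<lambda>i. \<Sum>k\<in>K. c i k *\<^sub>R w i k) \<longlongrightarrow> (\<Sum>k\<in>K. d k *\<^sub>R v k)) F"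
    and k: "k \<in> K"
  shows "((\<lambda>i. c i k) \<longlongrightarrow> d k) F"
proof -
  have "\<exists>B. B > 0 \<and> (\<forall>e. \<bar>e k\<bar> \<le> B * norm (\<Sum>l\<in>K. e l *\<^sub>R v l))" if k: "k \<in> K" for k
  proof -
    obtain g :: "'a \<Rightarrow> real" where g: "linear g" "\<And>l. l \<in> K \<Longrightarrow> g (v l) = (if l = k then 1 else 0)"
    proof -
      obtain g :: "'a \<Rightarrow> real" where g: "linear g" "\<forall>x\<in>v ` K. g x = (if x = v k then 1 else 0)"
        using linear_independent_extend[of "v ` K" "\<lambda>x. if x = v k then 1 else 0"] ind
        by (auto simp: independent_family_def)
      show thesis
        using g ind k by (intro that[of g]) (auto simp: independent_family_def dest: inj_onD)
    qed
    interpret g: linear g by (rule g)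
    obtain B where B: "B > 0" "\<And>x. norm (g x) \<le> B * norm x"
      using linear_bounded_pos[OF g(1)] by blast
    have "g (\<Sum>l\<in>K. e l *\<^sub>R v l) = e k" for e
      using k fin by (simp add: g.sum g.scaleR g(2) if_distrib sum.delta cong: sum.cong if_cong)
    then show ?thesis using B by (metis real_norm_def)
  qed
  then obtain B where B: "\<And>k. k \<in> K \<Longrightarrow> B k > 0"
    "\<And>k e. k \<in> K \<Longrightarrow> \<bar>e k\<bar> \<le> B k * norm (\<Sum>l\<in>K. e l *\<^sub>R v l)"
    by metis
  define b where "b = (\<Sum>k\<in>K. B k)"
  have b0: "b \<ge> 0" unfolding b_def using B(1) by (intro sum_nonneg) (simp add: less_imp_le)
  define E where "E i = (\<Sum>k\<in>K. \<bar>c i k - d k\<bar>)" for i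
  define r where "r i = (\<Sum>k\<in>K. c i k *\<^sub>R w i k) - (\<Sum>k\<in>K. d k *\<^sub>R w i k)" for i
  define m where "m i = (\<Sum>k\<in>K. norm (w i k - v k))" for i
  have "((\<lambda>i. (\<Sum>k\<in>K. c i k *\<^sub>R w i k) - (\<Sum>k\<in>K. d k *\<^sub>R w i k))
      \<longlongrightarrow> (\<Sum>k\<in>K. d k *\<^sub>R v k) - (\<Sum>k\<in>K. d k *\<^sub>R v k)) F"
    by (intro tendsto_diff sum tendsto_sum tendsto_scaleR tendsto_const w)
  then have r: "((\<lambda>i. norm (r i)) \<longlongrightarrow> 0) F"
    by (simp add: r_def tendsto_norm_zero)
  have "((\<lambda>i. \<Sum>k\<in>K. norm (w i k - v k)) \<longlongrightarrow> (\<Sum>k\<in>K. norm (v k - v k))) F"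
    by (intro tendsto_sum tendsto_norm tendsto_diff w tendsto_const)
  then have m: "(m \<longlongrightarrow> 0) F" by (simp add: m_def[abs_def])
  \<comment> \<open>The factor \<open>E i\<close> on the right is harmless, as \<open>b * m i\<close> eventually is below \<open>1 / 2\<close>.\<close>
  have main: "E i \<le> b * (norm (r i) + E i * m i)" for i
  proof -
    have le: "\<bar>c i l - d l\<bar> \<le> E i" if "l \<in> K" for l
      unfolding E_def using that fin by (intro member_le_sum) auto
    have "(\<Sum>l\<in>K. (c i l - d l) *\<^sub>R v l) = r i - (\<Sum>l\<in>K. (c i l - d l) *\<^sub>R (w i l - v l))"
      unfolding r_def sum_subtractf[symmetric] by (intro sum.cong) (simp_all add: algebra_simps)
    also have "norm \<dots> \<le> norm (r i) + (\<Sum>l\<in>K. norm ((c i l - d l) *\<^sub>R (w i l - v l)))"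
      by (intro order_trans[OF norm_triangle_ineq4] add_left_mono norm_sum)
    also have "\<dots> \<le> norm (r i) + E i * m i"
      unfolding m_def sum_distrib_left using le
      by (intro add_left_mono sum_mono) (simp add: mult_right_mono)
    finally have "norm (\<Sum>l\<in>K. (c i l - d l) *\<^sub>R v l) \<le> norm (r i) + E i * m i" .
    then have "\<bar>c i l - d l\<bar> \<le> B l * (norm (r i) + E i * m i)" if "l \<in> K" for l
      using B(2)[OF that, of "\<lambda>l. c i l - d l"] B(1)[OF that]
      by (meson less_imp_le mult_left_mono order_trans)
    then show ?thesis
      unfolding b_def sum_distrib_right by (subst E_def) (intro sum_mono)
  qed
  have "\<forall>\<^sub>F i in F. b * m i < 1 / 2"
    using tendsto_mult_left[OF m, of b] by (intro order_tendstoD(2)) auto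
  then have "\<forall>\<^sub>F i in F. norm (c i k - d k) \<le> norm (r i) * (2 * b)"
  proof eventually_elim
    case (elim i)
    have E0: "E i \<ge> 0" by (simp add: E_def sum_nonneg)
    have "E i * (b * m i) \<le> E i * (1 / 2)"
      using elim E0 by (intro mult_left_mono) auto
    then have "E i \<le> 2 * b * norm (r i)"
      using main[of i] by (simp add: algebra_simps)
    moreover have "\<bar>c i k - d k\<bar> \<le> E i"
      unfolding E_def using k fin by (intro member_le_sum) auto
    ultimately show ?case by (simp add: mult_ac)
  qed
  then have "((\<lambda>i. c i k - d k) \<longlongrightarrow> 0) F"
    by (rule tendsto_0_le[OF tendsto_norm_zero_cancel[OF r]])
  then show ?thesis by (simp add: LIM_zero_iff)
qed

text \<open>
  Filter version of passing to a convergent subsequence along which \<open>P\<close> holds.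
\<close>

lemma frequently_compact_cluster_point:
  fixes y :: "'i \<Rightarrow> 'a::topological_space"
  assumes K: "compact K" and P: "\<exists>\<^sub>F i in F. P i" and y: "\<And>i. P i \<Longrightarrow> y i \<in> K"
  obtains G l where "G \<le> F" "G \<noteq> bot" "eventually P G" "(y \<longlongrightarrow> l) G" "l \<in> K"
proof -
  define H where "H = inf F (principal {i. P i})"
  have "H \<noteq> bot"
    using P by (auto simp: H_def frequently_def trivial_limit_def eventually_inf_principal)
  have PH: "eventually P H" by (auto simp: H_def eventually_inf_principal)
  then have "eventually (\<lambda>z. z \<in> K) (filtermap y H)"
    using y by (auto simp: eventually_filtermap elim: eventually_mono)
  with \<open>H \<noteq> bot\<close> obtain l where l: "l \<in> K" "inf (nhds l) (filtermap y H) \<noteq> bot"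
    using K unfolding compact_filter by (metis filtermap_bot_iff)
  define G where "G = inf (filtercomap y (nhds l)) H"
  have "G \<noteq> bot"
  proof
    assume "G = bot"
    then have "eventually (\<lambda>_. False) G" by simp
    then obtain Q R where "eventually Q (filtercomap y (nhds l))" and R: "eventually R H"
      and QR: "\<And>i. Q i \<Longrightarrow> R i \<Longrightarrow> False"
      unfolding G_def eventually_inf by blast
    then obtain Q' where Q': "eventually Q' (nhds l)" "\<And>i. Q' (y i) \<Longrightarrow> Q i"
      unfolding eventually_filtercomap by blast
    have "eventually (\<lambda>z. \<not> Q' z) (filtermap y H)"
      unfolding eventually_filtermap using R by (rule eventually_mono) (use Q'(2) QR in blast)
    with Q'(1) have "eventually (\<lambda>_. False) (inf (nhds l) (filtermap y H))"
      unfolding eventually_inf by blast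
    with l(2) show False by (simp add: trivial_limit_def)
  qed
  moreover have "G \<le> F" by (simp add: G_def H_def le_infI2)
  moreover have "eventually P G" unfolding G_def by (rule filter_leD[OF inf_le2 PH])
  moreover have "(y \<longlongrightarrow> l) G"
    unfolding filterlim_iff_le_filtercomap G_def by simp
  ultimately show thesis using l that by blast
qed

section \<open>Quadratic forms near a biactive limit\<close>

text \<open>
  This locale isolates what happens to the restricted Hessians near the limit point.  The numbers
  \<open>a\<close>, \<open>b\<close> stand for the values of \<open>F1\<close>, \<open>F2\<close> at the approximating points, \<open>g1\<close>, \<open>g2\<close> for their
  gradients, and \<open>\<mu>1 = - \<eta> b\<close>, \<open>\<mu>2 = - \<eta> a\<close> for the coefficients of these gradients in the
  Karush-Kuhn-Tucker equation.  The matrix \<open>M\<close> is the part of the Hessian that converges, to the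
  Hessian \<open>M0\<close> of the limiting Lagrange function; the rest of the quadratic form consists of the
  mixed terms \<open>2 \<eta> (g1 \<bullet> \<xi>) (g2 \<bullet> \<xi>)\<close>, whose factors \<open>\<eta>\<close> are unbounded at biactive indices.
\<close>

locale complementarity_smoothing =
  fixes F :: "'i filter"
    and a b \<mu>1 \<mu>2 \<eta> :: "'i \<Rightarrow> 'k::finite \<Rightarrow> real"
    and g1 g2 :: "'i \<Rightarrow> 'k \<Rightarrow> real^'n"
    and M :: "'i \<Rightarrow> real^'n^'n"
    and a0 b0 m1 m2 :: "'k \<Rightarrow> real"
    and h1 h2 :: "'k \<Rightarrow> real^'n"
    and M0 :: "real^'n^'n"
  assumes lim_a: "\<And>j. ((\<lambda>i. a i j) \<longlongrightarrow> a0 j) F"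
    and lim_b: "\<And>j. ((\<lambda>i. b i j) \<longlongrightarrow> b0 j) F"
    and lim_\<mu>1: "\<And>j. ((\<lambda>i. \<mu>1 i j) \<longlongrightarrow> m1 j) F"
    and lim_\<mu>2: "\<And>j. ((\<lambda>i. \<mu>2 i j) \<longlongrightarrow> m2 j) F"
    and lim_g1: "\<And>j. ((\<lambda>i. g1 i j) \<longlongrightarrow> h1 j) F"
    and lim_g2: "\<And>j. ((\<lambda>i. g2 i j) \<longlongrightarrow> h2 j) F"
    and lim_M: "(M \<longlongrightarrow> M0) F"
    and pos: "\<And>i j. a i j > 0" "\<And>i j. b i j > 0"
    and \<mu>1_eq: "\<And>i j. \<mu>1 i j = - \<eta> i j * b i j"
    and \<mu>2_eq: "\<And>i j. \<mu>2 i j = - \<eta> i j * a i j"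
    and complementary: "\<And>j. a0 j * b0 j = 0"
    and limit_nonneg: "\<And>j. a0 j \<ge> 0" "\<And>j. b0 j \<ge> 0"
    and biactive: "\<And>j. a0 j = 0 \<Longrightarrow> b0 j = 0 \<Longrightarrow> m1 j * m2 j > 0"
begin

definition form :: "'i \<Rightarrow> real^'n \<Rightarrow> real" where
  "form i \<xi> = \<xi> \<bullet> (M i *v \<xi>) + (\<Sum>j\<in>UNIV. 2 * \<eta> i j * (g1 i j \<bullet> \<xi>) * (g2 i j \<bullet> \<xi>))"

definition tangent :: "'i \<Rightarrow> (real^'n) set" where
  "tangent i = {\<xi>. \<forall>j. (b i j *\<^sub>R g1 i j + a i j *\<^sub>R g2 i j) \<bullet> \<xi> = 0}"

definition limit_tangent :: "(real^'n) set" where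
  "limit_tangent = {\<xi>. \<forall>j. (a0 j = 0 \<longrightarrow> h1 j \<bullet> \<xi> = 0) \<and> (b0 j = 0 \<longrightarrow> h2 j \<bullet> \<xi> = 0)}"

text \<open>
  On the tangent space \<open>b (g1 \<bullet> \<xi>) = - a (g2 \<bullet> \<xi>)\<close>.  If one of \<open>a0 j\<close>, \<open>b0 j\<close> is positive, then \<open>\<eta>\<close>
  stays bounded and the \<open>j\<close>-th mixed term vanishes in the limit.  At a biactive index the mixed term
  equals \<open>2 (\<mu>1 / a) (g1 \<bullet> \<xi>)\<^sup>2\<close> with \<open>a\<close> tending to zero and \<open>\<mu>1\<close> to \<open>m1 \<noteq> 0\<close>: it blows up with the
  sign of \<open>m1\<close> unless \<open>g1 \<bullet> \<xi>\<close> tends to zero.  Hence, if all mixed terms that survive have the sign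
  opposite to \<open>s\<close>, unit directions with \<open>s * form \<ge> 0\<close> can only accumulate in the tangent
  space of the limit problem, and there the limiting form inherits the inequality.
\<close>

lemma limit_of_tangent_directions:
  assumes G: "G \<le> F" "G \<noteq> bot" and \<xi>: "(\<xi> \<longlongrightarrow> \<xi>0) G"
    and tan: "\<forall>\<^sub>F i in G. \<xi> i \<in> tangent i"
    and J: "\<And>j. a0 j = 0 \<Longrightarrow> b0 j = 0 \<Longrightarrow> s * m1 j < 0 \<or> (\<forall>\<^sub>F i in G. g1 i j \<bullet> \<xi> i = 0)"
    and nonneg: "\<forall>\<^sub>F i in G. s * form i (\<xi> i) \<ge> 0"
  shows "\<xi>0 \<in> limit_tangent" and "s * (\<xi>0 \<bullet> (M0 *v \<xi>0)) \<ge> 0"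
proof -
  note mono = tendsto_mono[OF G(1)]
  note lims = lim_a[THEN mono] lim_b[THEN mono] lim_\<mu>1[THEN mono] lim_\<mu>2[THEN mono]
    lim_g1[THEN mono] lim_g2[THEN mono] lim_M[THEN mono] \<xi>
  define D where "D = {j. a0 j = 0 \<and> b0 j = 0}"
  have d1: "((\<lambda>i. g1 i j \<bullet> \<xi> i) \<longlongrightarrow> h1 j \<bullet> \<xi>0) G" for j by (intro tendsto_inner lims)
  have d2: "((\<lambda>i. g2 i j \<bullet> \<xi> i) \<longlongrightarrow> h2 j \<bullet> \<xi>0) G" for j by (intro tendsto_inner lims)
  have tan': "\<forall>\<^sub>F i in G. b i j * (g1 i j \<bullet> \<xi> i) + a i j * (g2 i j \<bullet> \<xi> i) = 0" for j
    using tan by eventually_elim (simp add: tangent_def inner_add_left)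
  have limit_eq: "b0 j * (h1 j \<bullet> \<xi>0) + a0 j * (h2 j \<bullet> \<xi>0) = 0" for j
  proof (rule tendsto_unique[OF G(2)])
    show "((\<lambda>i. b i j * (g1 i j \<bullet> \<xi> i) + a i j * (g2 i j \<bullet> \<xi> i))
        \<longlongrightarrow> b0 j * (h1 j \<bullet> \<xi>0) + a0 j * (h2 j \<bullet> \<xi>0)) G"
      by (intro tendsto_intros lims d1 d2)
    show "((\<lambda>i. b i j * (g1 i j \<bullet> \<xi> i) + a i j * (g2 i j \<bullet> \<xi> i)) \<longlongrightarrow> 0) G"
      by (rule tendsto_eventually[OF tan'])
  qed
  define X where "X i j = 2 * \<eta> i j * (g1 i j \<bullet> \<xi> i) * (g2 i j \<bullet> \<xi> i)" for i j
  have \<eta>1: "\<eta> i j = - \<mu>1 i j / b i j" and \<eta>2: "\<eta> i j = - \<mu>2 i j / a i j" for i j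
    using pos(1)[of i j] pos(2)[of i j] by (simp_all add: \<mu>1_eq \<mu>2_eq)
  have X0: "((\<lambda>i. X i j) \<longlongrightarrow> 0) G" if "j \<notin> D" for j
  proof (cases "b0 j = 0")
    case False
    then have z: "a0 j = 0" "h1 j \<bullet> \<xi>0 = 0"
      using complementary[of j] limit_eq[of j] by auto
    have "((\<lambda>i. X i j) \<longlongrightarrow> 2 * (- m1 j / b0 j) * (h1 j \<bullet> \<xi>0) * (h2 j \<bullet> \<xi>0)) G"
      unfolding X_def \<eta>1 using False by (intro tendsto_intros lims d1 d2)
    with z show ?thesis by simp
  next
    case True
    with that have nz: "a0 j \<noteq> 0" by (simp add: D_def)
    then have z: "h2 j \<bullet> \<xi>0 = 0"
      using True limit_eq[of j] by auto
    have "((\<lambda>i. X i j) \<longlongrightarrow> 2 * (- m2 j / a0 j) * (h1 j \<bullet> \<xi>0) * (h2 j \<bullet> \<xi>0)) G"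
      unfolding X_def \<eta>2 using nz by (intro tendsto_intros lims d1 d2)
    with z show ?thesis by simp
  qed
  have XD: "\<forall>\<^sub>F i in G. X i j = 2 * \<mu>1 i j * (g1 i j \<bullet> \<xi> i)\<^sup>2 / a i j" for j
    using tan'[of j]
  proof eventually_elim
    case (elim i)
    have "g2 i j \<bullet> \<xi> i = - b i j * (g1 i j \<bullet> \<xi> i) / a i j"
      using elim pos(1)[of i j] by (simp add: field_simps)
    then show ?case
      using pos(1)[of i j] pos(2)[of i j] by (simp add: X_def \<mu>1_eq power2_eq_square)
  qed
  have Xle: "\<forall>\<^sub>F i in G. s * X i j \<le> 0" if "j \<in> D" for j
  proof -
    from J[of j] that consider "s * m1 j < 0" | "\<forall>\<^sub>F i in G. g1 i j \<bullet> \<xi> i = 0"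
      by (auto simp: D_def)
    then show ?thesis
    proof cases
      case 1
      have "\<forall>\<^sub>F i in G. s * \<mu>1 i j < 0"
        by (intro order_tendstoD(2)[OF _ 1] tendsto_intros lims)
      then show ?thesis using XD[of j]
      proof eventually_elim
        case (elim i)
        have "s * X i j = s * \<mu>1 i j * (2 * (g1 i j \<bullet> \<xi> i)\<^sup>2 / a i j)"
          unfolding elim(2) by (simp add: mult_ac)
        also have "\<dots> \<le> 0"
          using pos(1)[of i j] by (intro mult_nonpos_nonneg[OF less_imp_le[OF elim(1)]]) simp
        finally show ?case .
      qed
    next
      case 2
      then show ?thesis by eventually_elim (simp add: X_def)
    qed
  qed
  \<comment> \<open>\<open>R\<close> is the convergent part; the biactive terms only lower \<open>s * form\<close>, so \<open>R\<close> is nonnegative with it.\<close>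
  define R where "R i = s * (\<xi> i \<bullet> (M i *v \<xi> i)) + (\<Sum>j\<in>-D. s * X i j)" for i
  have "(R \<longlongrightarrow> s * (\<xi>0 \<bullet> (M0 *v \<xi>0)) + (\<Sum>j\<in>-D. s * 0)) G"
    unfolding R_def by (intro tendsto_intros lims X0) auto
  then have R: "(R \<longlongrightarrow> s * (\<xi>0 \<bullet> (M0 *v \<xi>0))) G" by simp
  have split: "s * form i (\<xi> i) = R i + (\<Sum>j\<in>D. s * X i j)" for i
  proof -
    have "(\<Sum>j\<in>UNIV. s * X i j) = (\<Sum>j\<in>D. s * X i j) + (\<Sum>j\<in>-D. s * X i j)"
      by (subst sum.union_disjoint[symmetric]) (auto simp: Compl_partition)
    then show ?thesis
      by (simp add: form_def R_def X_def distrib_left sum_distrib_left)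
  qed
  have allXle: "\<forall>\<^sub>F i in G. \<forall>j\<in>D. s * X i j \<le> 0"
    using Xle by (simp add: eventually_ball_finite_distrib)
  have "\<forall>\<^sub>F i in G. R i \<ge> 0"
    using nonneg allXle
  proof eventually_elim
    case (elim i)
    have "(\<Sum>j\<in>D. s * X i j) \<le> 0" using elim(2) by (intro sum_nonpos) auto
    with elim(1) split[of i] show ?case by simp
  qed
  from tendsto_lowerbound[OF R this G(2)] show "s * (\<xi>0 \<bullet> (M0 *v \<xi>0)) \<ge> 0" .
  \<comment> \<open>Multiplying by \<open>a i j\<close>, which tends to zero, makes \<open>R\<close> negligible but not the \<open>j\<close>-th mixed term.\<close>
  have h1D: "h1 j \<bullet> \<xi>0 = 0" if j: "j \<in> D" for j
  proof -
    from J[of j] that consider "s * m1 j < 0" | "\<forall>\<^sub>F i in G. g1 i j \<bullet> \<xi> i = 0"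
      by (auto simp: D_def)
    then show ?thesis
    proof cases
      case 1
      have "((\<lambda>i. a i j * R i + 2 * (s * \<mu>1 i j) * (g1 i j \<bullet> \<xi> i)\<^sup>2)
          \<longlongrightarrow> a0 j * (s * (\<xi>0 \<bullet> (M0 *v \<xi>0))) + 2 * (s * m1 j) * (h1 j \<bullet> \<xi>0)\<^sup>2) G"
        by (intro tendsto_intros lims R d1)
      moreover have "\<forall>\<^sub>F i in G. a i j * R i + 2 * (s * \<mu>1 i j) * (g1 i j \<bullet> \<xi> i)\<^sup>2 \<ge> 0"
        using nonneg allXle XD[of j]
      proof eventually_elim
        case (elim i)
        have "(\<Sum>k\<in>D. s * X i k) = s * X i j + (\<Sum>k\<in>D - {j}. s * X i k)"
          using j by (simp add: sum.remove)
        moreover have "(\<Sum>k\<in>D - {j}. s * X i k) \<le> 0" using elim(2) by (intro sum_nonpos) auto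
        ultimately have "0 \<le> R i + s * X i j" using elim(1) split[of i] by simp
        then have "0 \<le> a i j * (R i + s * X i j)"
          using pos(1)[of i j] by simp
        also have "\<dots> = a i j * R i + 2 * (s * \<mu>1 i j) * (g1 i j \<bullet> \<xi> i)\<^sup>2"
          unfolding elim(3) using pos(1)[of i j] by (simp add: field_simps)
        finally show ?case .
      qed
      ultimately have "0 \<le> a0 j * (s * (\<xi>0 \<bullet> (M0 *v \<xi>0))) + 2 * (s * m1 j) * (h1 j \<bullet> \<xi>0)\<^sup>2"
        by (rule tendsto_lowerbound[OF _ _ G(2)])
      then have "0 \<le> (s * m1 j) * (h1 j \<bullet> \<xi>0)\<^sup>2" using j by (simp add: D_def)
      moreover have "(s * m1 j) * (h1 j \<bullet> \<xi>0)\<^sup>2 < 0" if "h1 j \<bullet> \<xi>0 \<noteq> 0"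
        using that by (intro mult_neg_pos[OF 1]) simp
      ultimately show ?thesis by fastforce
    next
      case 2
      show ?thesis by (rule tendsto_unique[OF G(2) d1 tendsto_eventually[OF 2]])
    qed
  qed
  \<comment> \<open>Multiplying the tangency equation by \<open>- \<eta>\<close> gives one whose coefficients have nonzero limits.\<close>
  have h2D: "h2 j \<bullet> \<xi>0 = 0" if j: "j \<in> D" for j
  proof -
    have "m1 j * (h1 j \<bullet> \<xi>0) + m2 j * (h2 j \<bullet> \<xi>0) = 0"
    proof (rule tendsto_unique[OF G(2)])
      show "((\<lambda>i. \<mu>1 i j * (g1 i j \<bullet> \<xi> i) + \<mu>2 i j * (g2 i j \<bullet> \<xi> i))
          \<longlongrightarrow> m1 j * (h1 j \<bullet> \<xi>0) + m2 j * (h2 j \<bullet> \<xi>0)) G"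
        by (intro tendsto_intros lims d1 d2)
      have "\<forall>\<^sub>F i in G. \<mu>1 i j * (g1 i j \<bullet> \<xi> i) + \<mu>2 i j * (g2 i j \<bullet> \<xi> i) = 0"
        using tan'[of j]
      proof eventually_elim
        case (elim i)
        have "\<mu>1 i j * (g1 i j \<bullet> \<xi> i) + \<mu>2 i j * (g2 i j \<bullet> \<xi> i)
            = - \<eta> i j * (b i j * (g1 i j \<bullet> \<xi> i) + a i j * (g2 i j \<bullet> \<xi> i))"
          by (simp add: \<mu>1_eq \<mu>2_eq algebra_simps)
        with elim show ?case by simp
      qed
      then show "((\<lambda>i. \<mu>1 i j * (g1 i j \<bullet> \<xi> i) + \<mu>2 i j * (g2 i j \<bullet> \<xi> i)) \<longlongrightarrow> 0) G"
        by (rule tendsto_eventually)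
    qed
    with h1D[OF j] biactive[of j] j show ?thesis by (auto simp: D_def)
  qed
  show "\<xi>0 \<in> limit_tangent"
    unfolding limit_tangent_def
  proof (intro CollectI allI conjI impI)
    fix j
    show "h1 j \<bullet> \<xi>0 = 0" if "a0 j = 0"
      using that h1D[of j] limit_eq[of j] by (cases "b0 j = 0") (auto simp: D_def)
    show "h2 j \<bullet> \<xi>0 = 0" if "b0 j = 0"
      using that h2D[of j] limit_eq[of j] by (cases "a0 j = 0") (auto simp: D_def)
  qed
qed

text \<open>
  If definiteness failed arbitrarily late, normalised directions of failure would accumulate at a
  unit vector that contradicts the definiteness of the limiting form.
\<close>

lemma eventually_definite:
  assumes J: "\<And>j. a0 j = 0 \<Longrightarrow> b0 j = 0 \<Longrightarrow> j \<in> J \<or> s * m1 j < 0"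
    and def: "\<And>\<xi>. \<xi> \<in> limit_tangent \<Longrightarrow> \<forall>w\<in>W. w \<bullet> \<xi> = 0 \<Longrightarrow> \<xi> \<noteq> 0 \<Longrightarrow> s * (\<xi> \<bullet> (M0 *v \<xi>)) < 0"
  shows "\<forall>\<^sub>F i in F. \<forall>\<xi>\<in>tangent i. (\<forall>j\<in>J. g1 i j \<bullet> \<xi> = 0) \<longrightarrow> (\<forall>w\<in>W. w \<bullet> \<xi> = 0) \<longrightarrow> \<xi> \<noteq> 0
    \<longrightarrow> s * form i \<xi> < 0"
proof (rule ccontr)
  define bad where "bad i \<xi> \<longleftrightarrow> \<xi> \<in> tangent i \<and> (\<forall>j\<in>J. g1 i j \<bullet> \<xi> = 0)
    \<and> (\<forall>w\<in>W. w \<bullet> \<xi> = 0) \<and> s * form i \<xi> \<ge> 0 \<and> \<xi> \<in> sphere 0 1" for i \<xi>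
  define \<xi> where "\<xi> i = (SOME \<xi>. bad i \<xi>)" for i
  assume "\<not> ?thesis"
  then have "\<exists>\<^sub>F i in F. \<exists>\<xi>\<in>tangent i. (\<forall>j\<in>J. g1 i j \<bullet> \<xi> = 0) \<and> (\<forall>w\<in>W. w \<bullet> \<xi> = 0) \<and> \<xi> \<noteq> 0
    \<and> s * form i \<xi> \<ge> 0"
    by (simp add: not_eventually not_less)
  then have freq: "\<exists>\<^sub>F i in F. bad i (\<xi> i)"
  proof (rule frequently_elim1)
    fix i
    assume "\<exists>\<xi>\<in>tangent i. (\<forall>j\<in>J. g1 i j \<bullet> \<xi> = 0) \<and> (\<forall>w\<in>W. w \<bullet> \<xi> = 0) \<and> \<xi> \<noteq> 0
      \<and> s * form i \<xi> \<ge> 0"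
    then obtain \<zeta> where \<zeta>: "\<zeta> \<in> tangent i" "\<forall>j\<in>J. g1 i j \<bullet> \<zeta> = 0" "\<forall>w\<in>W. w \<bullet> \<zeta> = 0" "\<zeta> \<noteq> 0"
      "s * form i \<zeta> \<ge> 0" by blast
    define c where "c = inverse (norm \<zeta>)"
    have "form i (c *\<^sub>R \<zeta>) = c\<^sup>2 * form i \<zeta>"
      by (simp add: form_def matrix_vector_mult_scaleR power2_eq_square distrib_left
          sum_distrib_left mult_ac)
    then have "s * form i (c *\<^sub>R \<zeta>) = c\<^sup>2 * (s * form i \<zeta>)" by simp
    also have "\<dots> \<ge> 0" using mult_nonneg_nonneg[OF zero_le_power2 \<zeta>(5)] .
    finally have "bad i (c *\<^sub>R \<zeta>)"
      using \<zeta> by (auto simp: bad_def tangent_def c_def)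
    then show "bad i (\<xi> i)" unfolding \<xi>_def by (rule someI)
  qed
  obtain G \<xi>0 where G: "G \<le> F" "G \<noteq> bot" and bad: "\<forall>\<^sub>F i in G. bad i (\<xi> i)"
    and lim: "(\<xi> \<longlongrightarrow> \<xi>0) G" and \<xi>0: "\<xi>0 \<in> sphere 0 1"
    by (rule frequently_compact_cluster_point[OF compact_sphere[of 0 1] freq])
      (auto simp: bad_def)
  have tan: "\<forall>\<^sub>F i in G. \<xi> i \<in> tangent i" and nonneg: "\<forall>\<^sub>F i in G. s * form i (\<xi> i) \<ge> 0"
    using bad by (auto simp: bad_def elim: eventually_mono)
  have "s * m1 j < 0 \<or> (\<forall>\<^sub>F i in G. g1 i j \<bullet> \<xi> i = 0)" if "a0 j = 0" "b0 j = 0" for j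
  proof (cases "j \<in> J")
    case True
    have "\<forall>\<^sub>F i in G. g1 i j \<bullet> \<xi> i = 0"
      using bad by eventually_elim (use True in \<open>simp add: bad_def\<close>)
    then show ?thesis ..
  qed (use J[OF that] in simp)
  note limit = limit_of_tangent_directions[OF G lim tan this nonneg]
  have "w \<bullet> \<xi>0 = 0" if "w \<in> W" for w
  proof (rule tendsto_unique[OF G(2)])
    show "((\<lambda>i. w \<bullet> \<xi> i) \<longlongrightarrow> w \<bullet> \<xi>0) G" by (intro tendsto_intros lim)
    have "\<forall>\<^sub>F i in G. w \<bullet> \<xi> i = 0" using bad that by (auto simp: bad_def elim: eventually_mono)
    then show "((\<lambda>i. w \<bullet> \<xi> i) \<longlongrightarrow> 0) G" by (rule tendsto_eventually)
  qed
  moreover have "\<xi>0 \<noteq> 0" using \<xi>0 by auto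
  ultimately have "s * (\<xi>0 \<bullet> (M0 *v \<xi>0)) < 0" using def[OF limit(1)] by blast
  with limit(2) show False by simp
qed

text \<open>
  The definite subspace is cut out of the tangent space by orthogonality to \<open>g1 i j\<close>, \<open>j \<in> J\<close>, and
  to \<open>W\<close>.  Describing it by equations, instead of transporting a basis from the limit point, makes
  the lower bound on its dimension a mere count of equations.
\<close>

lemma eventually_definite_subspace:
  assumes J: "\<And>j. a0 j = 0 \<Longrightarrow> b0 j = 0 \<Longrightarrow> j \<in> J \<or> s * m1 j < 0"
    and def: "\<And>\<xi>. \<xi> \<in> limit_tangent \<Longrightarrow> (\<And>w. w \<in> W \<Longrightarrow> w \<bullet> \<xi> = 0) \<Longrightarrow> \<xi> \<noteq> 0
      \<Longrightarrow> s * (\<xi> \<bullet> (M0 *v \<xi>)) < 0"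
  shows "\<forall>\<^sub>F i in F. \<exists>S. subspace S \<and> S \<subseteq> tangent i
    \<and> CARD('n) \<le> dim S + CARD('k) + card J + dim W \<and> (\<forall>\<xi>\<in>S. \<xi> \<noteq> 0 \<longrightarrow> s * form i \<xi> < 0)"
proof -
  have "\<forall>w\<in>W. w \<bullet> \<xi> = 0 \<Longrightarrow> \<xi> \<in> limit_tangent \<Longrightarrow> \<xi> \<noteq> 0 \<Longrightarrow> s * (\<xi> \<bullet> (M0 *v \<xi>)) < 0" for \<xi>
    using def by blast
  then have "\<forall>\<^sub>F i in F. \<forall>\<xi>\<in>tangent i. (\<forall>j\<in>J. g1 i j \<bullet> \<xi> = 0) \<longrightarrow> (\<forall>w\<in>W. w \<bullet> \<xi> = 0) \<longrightarrow> \<xi> \<noteq> 0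
    \<longrightarrow> s * form i \<xi> < 0"
    by (intro eventually_definite J)
  then show ?thesis
  proof eventually_elim
    case (elim i)
    obtain BW where BW: "BW \<subseteq> W" "independent BW" "W \<subseteq> span BW" "card BW = dim W"
      using basis_exists[of W] by blast
    have "finite BW" using BW(2) by (rule independent_imp_finite)
    define c where "c j = b i j *\<^sub>R g1 i j + a i j *\<^sub>R g2 i j" for j
    define B where "B = range c \<union> g1 i ` J \<union> BW"
    define S where "S = {v. \<forall>b\<in>B. b \<bullet> v = 0}"
    have "dim B \<le> card B"
      using \<open>finite BW\<close> by (intro dim_le_card') (simp add: B_def)
    also have "\<dots> \<le> card (range c) + card (g1 i ` J) + card BW"
      unfolding B_def by (intro order_trans[OF card_Un_le] add_mono card_Un_le order_refl)
    also have "\<dots> \<le> CARD('k) + card J + dim W"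
      using BW(4) by (intro add_mono card_image_le) auto
    finally have "CARD('n) \<le> dim S + CARD('k) + card J + dim W"
      using dim_orthogonal_complement[of B] by (simp add: S_def)
    moreover have "subspace S"
      unfolding S_def by (rule subspace_orthogonal_complement)
    moreover have tan: "S \<subseteq> tangent i"
      by (auto simp: S_def B_def tangent_def c_def)
    moreover have "s * form i \<xi> < 0" if \<xi>: "\<xi> \<in> S" "\<xi> \<noteq> 0" for \<xi>
    proof -
      have "span BW \<subseteq> {b. \<xi> \<bullet> b = 0}"
        using \<xi> by (intro span_minimal subspace_hyperplane) (auto simp: S_def B_def inner_commute)
      then have "\<forall>w\<in>W. w \<bullet> \<xi> = 0"
        using BW(3) by (auto simp: inner_commute)
      moreover have "\<forall>j\<in>J. g1 i j \<bullet> \<xi> = 0"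
        using \<xi> by (auto simp: S_def B_def)
      ultimately show ?thesis using elim \<xi> tan by blast
    qed
    ultimately show ?case by blast
  qed
qed

end

text \<open>
  At an index with \<open>b0 j \<noteq> 0\<close> the two gradients enter the Karush-Kuhn-Tucker equation through the
  single vector \<open>g1 + (a / b) g2\<close>, which tends to \<open>h1\<close> because \<open>a\<close> tends to zero there; symmetrically
  for \<open>a0 j \<noteq> 0\<close>.  With the vectors merged in this way the family converges to the independent family
  of MPCC-LICQ, so the coefficients converge.
\<close>

lemma complementarity_multipliers_tendsto:
  fixes a b \<eta> :: "'i \<Rightarrow> 'k::finite \<Rightarrow> real" and g1 g2 :: "'i \<Rightarrow> 'k \<Rightarrow> real^'n"
  assumes a: "\<And>j. ((\<lambda>i. a i j) \<longlongrightarrow> a0 j) F" and b: "\<And>j. ((\<lambda>i. b i j) \<longlongrightarrow> b0 j) F"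
    and g1: "\<And>j. ((\<lambda>i. g1 i j) \<longlongrightarrow> h1 j) F" and g2: "\<And>j. ((\<lambda>i. g2 i j) \<longlongrightarrow> h2 j) F"
    and pos: "\<And>i j. a i j > 0" "\<And>i j. b i j > 0"
    and comp: "\<And>j. a0 j * b0 j = 0"
    and m: "\<And>j. a0 j \<noteq> 0 \<Longrightarrow> m1 j = 0" "\<And>j. b0 j \<noteq> 0 \<Longrightarrow> m2 j = 0"
    and ind: "independent_family (case_sum h1 h2) ({j. a0 j = 0} <+> {j. b0 j = 0})"
    and stat: "((\<lambda>i. \<Sum>j\<in>UNIV. (- \<eta> i j * b i j) *\<^sub>R g1 i j + (- \<eta> i j * a i j) *\<^sub>R g2 i j)
      \<longlongrightarrow> (\<Sum>j\<in>UNIV. m1 j *\<^sub>R h1 j + m2 j *\<^sub>R h2 j)) F"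
  shows "((\<lambda>i. - \<eta> i j * b i j) \<longlongrightarrow> m1 j) F" and "((\<lambda>i. - \<eta> i j * a i j) \<longlongrightarrow> m2 j) F"
proof -
  let ?K = "{j. a0 j = 0} <+> {j. b0 j = 0}"
  define w where "w i = case_sum
      (\<lambda>j. g1 i j + (if b0 j \<noteq> 0 then (a i j / b i j) *\<^sub>R g2 i j else 0))
      (\<lambda>j. g2 i j + (if a0 j \<noteq> 0 then (b i j / a i j) *\<^sub>R g1 i j else 0))" for i
  define c where "c i = case_sum (\<lambda>j. - \<eta> i j * b i j) (\<lambda>j. - \<eta> i j * a i j)" for i
  define d where "d = case_sum m1 m2"
  have sum_K: "(\<Sum>k\<in>?K. G k) = (\<Sum>j\<in>UNIV. (if a0 j = 0 then G (Inl j) else 0) + (if b0 j = 0 then G (Inr j) else 0))"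
    for G :: "'k + 'k \<Rightarrow> real^'n"
    by (simp add: sum.Plus sum.distrib sum.If_cases)
  have "((\<lambda>i. w i k) \<longlongrightarrow> case_sum h1 h2 k) F" if "k \<in> ?K" for k
  proof (cases k)
    case (Inl j)
    have "((\<lambda>i. (a i j / b i j) *\<^sub>R g2 i j) \<longlongrightarrow> (a0 j / b0 j) *\<^sub>R h2 j) F" if "b0 j \<noteq> 0"
      using that by (intro tendsto_intros a b g2)
    moreover have "a0 j = 0" using that Inl by auto
    ultimately show ?thesis
      using tendsto_add[OF g1[of j], of _ 0] g1[of j] Inl
      by (cases "b0 j = 0") (auto simp: w_def)
  next
    case (Inr j)
    have "((\<lambda>i. (b i j / a i j) *\<^sub>R g1 i j) \<longlongrightarrow> (b0 j / a0 j) *\<^sub>R h1 j) F" if "a0 j \<noteq> 0"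
      using that by (intro tendsto_intros a b g1)
    moreover have "b0 j = 0" using that Inr by auto
    ultimately show ?thesis
      using tendsto_add[OF g2[of j], of _ 0] g2[of j] Inr
      by (cases "a0 j = 0") (auto simp: w_def)
  qed
  moreover have "(\<Sum>k\<in>?K. c i k *\<^sub>R w i k)
      = (\<Sum>j\<in>UNIV. (- \<eta> i j * b i j) *\<^sub>R g1 i j + (- \<eta> i j * a i j) *\<^sub>R g2 i j)" for i
    unfolding sum_K
  proof (intro sum.cong refl)
    fix j
    have "a0 j = 0 \<or> b0 j = 0" using comp[of j] by simp
    then show "(if a0 j = 0 then c i (Inl j) *\<^sub>R w i (Inl j) else 0)
        + (if b0 j = 0 then c i (Inr j) *\<^sub>R w i (Inr j) else 0)
      = (- \<eta> i j * b i j) *\<^sub>R g1 i j + (- \<eta> i j * a i j) *\<^sub>R g2 i j"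
      using pos(1)[of i j] pos(2)[of i j] by (auto simp: c_def w_def scaleR_add_right)
  qed
  moreover have "(\<Sum>k\<in>?K. d k *\<^sub>R case_sum h1 h2 k) = (\<Sum>j\<in>UNIV. m1 j *\<^sub>R h1 j + m2 j *\<^sub>R h2 j)"
    unfolding sum_K using m by (intro sum.cong refl) (auto simp: d_def)
  ultimately have lim: "((\<lambda>i. c i k) \<longlongrightarrow> d k) F" if "k \<in> ?K" for k
    using that stat by (intro independent_coefficients_tendsto[OF _ ind, of w F c d k]) auto
  show "((\<lambda>i. - \<eta> i j * b i j) \<longlongrightarrow> m1 j) F"
  proof (cases "a0 j = 0")
    case True
    then show ?thesis using lim[OF InlI, of j] by (simp add: c_def d_def)
  next
    case False
    with comp[of j] have "b0 j = 0" by simp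
    then have "((\<lambda>i. - \<eta> i j * a i j) \<longlongrightarrow> m2 j) F"
      using lim[OF InrI, of j] by (simp add: c_def d_def)
    then have "((\<lambda>i. - \<eta> i j * a i j * (b i j / a i j)) \<longlongrightarrow> m2 j * (b0 j / a0 j)) F"
      using False by (intro tendsto_intros a b)
    moreover have "- \<eta> i j * a i j * (b i j / a i j) = - \<eta> i j * b i j" for i
      using pos(1)[of i j] by simp
    ultimately show ?thesis using m(1)[OF False] \<open>b0 j = 0\<close> by simp
  qed
  show "((\<lambda>i. - \<eta> i j * a i j) \<longlongrightarrow> m2 j) F"
  proof (cases "b0 j = 0")
    case True
    then show ?thesis using lim[OF InrI, of j] by (simp add: c_def d_def)
  next
    case False
    with comp[of j] have "a0 j = 0" by simp
    then have "((\<lambda>i. - \<eta> i j * b i j) \<longlongrightarrow> m1 j) F"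
      using lim[OF InlI, of j] by (simp add: c_def d_def)
    then have "((\<lambda>i. - \<eta> i j * b i j * (a i j / b i j)) \<longlongrightarrow> m1 j * (a0 j / b0 j)) F"
      using False by (intro tendsto_intros a b)
    moreover have "- \<eta> i j * b i j * (a i j / b i j) = - \<eta> i j * a i j" for i
      using pos(2)[of i j] by simp
    ultimately show ?thesis using m(2)[OF False] \<open>a0 j = 0\<close> by simp
  qed
qed

section \<open>The C-index under smoothing\<close>

text \<open>
  Extending the multipliers by zero to all indices turns the three sums of the MPCC notions into one
  sum over all indices of the same shape as in the smoothed problem.
\<close>

definition multiplier1 ::
  "(real^'n \<Rightarrow> real^'k) \<Rightarrow> (real^'n \<Rightarrow> real^'k) \<Rightarrow> real^'n \<Rightarrow> ('k \<Rightarrow> real) \<Rightarrow> ('k \<Rightarrow> real) \<Rightarrow> 'k \<Rightarrow> real"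
  where "multiplier1 F1 F2 x \<sigma>1 \<rho>1 j =
    (if j \<in> a01 F1 F2 x then \<sigma>1 j else if j \<in> a00 F1 F2 x then \<rho>1 j else 0)"

definition multiplier2 ::
  "(real^'n \<Rightarrow> real^'k) \<Rightarrow> (real^'n \<Rightarrow> real^'k) \<Rightarrow> real^'n \<Rightarrow> ('k \<Rightarrow> real) \<Rightarrow> ('k \<Rightarrow> real) \<Rightarrow> 'k \<Rightarrow> real"
  where "multiplier2 F1 F2 x \<sigma>2 \<rho>2 j =
    (if j \<in> a10 F1 F2 x then \<sigma>2 j else if j \<in> a00 F1 F2 x then \<rho>2 j else 0)"

lemma multiplier_sum:
  fixes F1 F2 :: "real^'n \<Rightarrow> real^'k" and A B :: "'k \<Rightarrow> 'b::real_vector"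
  shows "(\<Sum>j\<in>a01 F1 F2 x. \<sigma>1 j *\<^sub>R A j) + (\<Sum>j\<in>a10 F1 F2 x. \<sigma>2 j *\<^sub>R B j)
      + (\<Sum>j\<in>a00 F1 F2 x. \<rho>1 j *\<^sub>R A j + \<rho>2 j *\<^sub>R B j)
    = (\<Sum>j\<in>UNIV. multiplier1 F1 F2 x \<sigma>1 \<rho>1 j *\<^sub>R A j + multiplier2 F1 F2 x \<sigma>2 \<rho>2 j *\<^sub>R B j)"
proof -
  have restrict: "(\<Sum>j\<in>S. g j) = (\<Sum>j\<in>UNIV. if j \<in> S then g j else 0)" for S and g :: "'k \<Rightarrow> 'b"
    using sum.inter_restrict[of UNIV g S] by simp
  have "(if j \<in> a01 F1 F2 x then \<sigma>1 j *\<^sub>R A j else 0) + (if j \<in> a10 F1 F2 x then \<sigma>2 j *\<^sub>R B j else 0)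
      + (if j \<in> a00 F1 F2 x then \<rho>1 j *\<^sub>R A j + \<rho>2 j *\<^sub>R B j else 0)
    = multiplier1 F1 F2 x \<sigma>1 \<rho>1 j *\<^sub>R A j + multiplier2 F1 F2 x \<sigma>2 \<rho>2 j *\<^sub>R B j" for j
    by (simp add: multiplier1_def multiplier2_def a01_def a10_def a00_def)
  then show ?thesis
    by (simp only: restrict[of _ "a01 F1 F2 x"] restrict[of _ "a10 F1 F2 x"]
        restrict[of _ "a00 F1 F2 x"] sum.distrib[symmetric])
qed

lemma lagrangian_eq:
  "lagrangian f F1 F2 x \<sigma>1 \<sigma>2 \<rho>1 \<rho>2 = (\<lambda>y. f y - (\<Sum>j\<in>UNIV.
     multiplier1 F1 F2 x \<sigma>1 \<rho>1 j * F1 y $ j + multiplier2 F1 F2 x \<sigma>2 \<rho>2 j * F2 y $ j))"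
proof
  fix y
  show "lagrangian f F1 F2 x \<sigma>1 \<sigma>2 \<rho>1 \<rho>2 y = f y - (\<Sum>j\<in>UNIV.
     multiplier1 F1 F2 x \<sigma>1 \<rho>1 j * F1 y $ j + multiplier2 F1 F2 x \<sigma>2 \<rho>2 j * F2 y $ j)"
    using multiplier_sum[of \<sigma>1 "\<lambda>j. F1 y $ j" F1 F2 x \<sigma>2 "\<lambda>j. F2 y $ j" \<rho>1 \<rho>2]
    by (simp add: lagrangian_def)
qed

lemma active_indices:
  assumes "x \<in> feasible F1 F2"
  shows "a01 F1 F2 x \<union> a00 F1 F2 x = {j. F1 x $ j = 0}"
    and "a10 F1 F2 x \<union> a00 F1 F2 x = {j. F2 x $ j = 0}"
proof -
  have "F1 x $ j \<ge> 0 \<and> F2 x $ j \<ge> 0" for j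
    using assms by (simp add: feasible_def)
  then show "a01 F1 F2 x \<union> a00 F1 F2 x = {j. F1 x $ j = 0}"
    "a10 F1 F2 x \<union> a00 F1 F2 x = {j. F2 x $ j = 0}"
    by (auto simp: a01_def a10_def a00_def less_le)
qed

text \<open>
  Each index contributes one active gradient, and each biactive index one more.
\<close>

lemma dim_tangent_space:
  fixes F1 F2 :: "real^'n \<Rightarrow> real^'k"
  assumes feas: "x \<in> feasible F1 F2" and licq: "MPCC_LICQ F1 F2 x"
  shows "dim (tangent_space F1 F2 x) + CARD('k) + card (a00 F1 F2 x) = CARD('n)"
proof -
  let ?I = "a01 F1 F2 x \<union> a00 F1 F2 x" and ?J = "a10 F1 F2 x \<union> a00 F1 F2 x"
  let ?v = "case_sum (\<lambda>j. grad (\<lambda>y. F1 y $ j) x) (\<lambda>j. grad (\<lambda>y. F2 y $ j) x)"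
  have "tangent_space F1 F2 x = {v. \<forall>b\<in>?v ` (?I <+> ?J). b \<bullet> v = 0}"
    by (simp add: tangent_space_def Plus_def ball_Un)
  moreover have "dim (?v ` (?I <+> ?J)) = card (?I <+> ?J)"
    using licq unfolding MPCC_LICQ_def by (rule dim_independent_family)
  moreover have "card (?I <+> ?J) = card ?I + card ?J"
    by (simp add: card_Plus)
  moreover have "card ?I + card ?J = card (?I \<union> ?J) + card (?I \<inter> ?J)"
    by (intro card_Un_Int) simp_all
  moreover have "?I \<union> ?J = UNIV" "?I \<inter> ?J = a00 F1 F2 x"
    unfolding active_indices[OF feas] using feas by (auto simp: feasible_def a00_def)
  ultimately show ?thesis
    using dim_orthogonal_complement[of "?v ` (?I <+> ?J)"] by simp
qed

lemma dim_tangent_space_S: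
  fixes F1 F2 :: "real^'n \<Rightarrow> real^'k"
  assumes "independent_family (constraint_grad_S F1 F2 x) UNIV"
  shows "dim (tangent_space_S F1 F2 x) + CARD('k) = CARD('n)"
  using dim_orthogonal_complement[of "range (constraint_grad_S F1 F2 x)"]
    dim_independent_family[OF assms]
  by (simp add: tangent_space_S_def)

lemma subspace_tangent_space: "subspace (tangent_space F1 F2 x)"
  by (auto simp: tangent_space_def subspace_def inner_add_right)

lemma subspace_tangent_space_S: "subspace (tangent_space_S F1 F2 x)"
  by (auto simp: tangent_space_S_def subspace_def inner_add_right)

lemma hessian_lagrangian_symmetric:
  assumes f: "C2 f" and F1: "C2_vec F1" and F2: "C2_vec F2"
  shows "(hessian (lagrangian f F1 F2 xbar \<sigma>1 \<sigma>2 \<rho>1 \<rho>2) x *v u) \<bullet> v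
    = u \<bullet> (hessian (lagrangian f F1 F2 xbar \<sigma>1 \<sigma>2 \<rho>1 \<rho>2) x *v v)"
proof -
  have "C2 (\<lambda>y. F1 y $ j)" "C2 (\<lambda>y. F2 y $ j)" for j
    using F1 F2 by (auto simp: C2_vec_def)
  note sym = f[THEN C2_hessian_symmetric] this[THEN C2_hessian_symmetric]
  show ?thesis
    unfolding lagrangian_eq
    by (simp add: hessian_linear_combination[OF assms] sym inner_diff_left inner_diff_right
        inner_sum_left inner_sum_right inner_add_left inner_add_right)
qed

lemma hessian_lagrangian_S_symmetric:
  assumes f: "C2 f" and F1: "C2_vec F1" and F2: "C2_vec F2"
  shows "(hessian (lagrangian_S f F1 F2 t \<eta>) x *v u) \<bullet> v
    = u \<bullet> (hessian (lagrangian_S f F1 F2 t \<eta>) x *v v)"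
proof -
  have "C2 (\<lambda>y. F1 y $ j)" "C2 (\<lambda>y. F2 y $ j)" for j
    using F1 F2 by (auto simp: C2_vec_def)
  note sym = f[THEN C2_hessian_symmetric] this[THEN C2_hessian_symmetric]
  show ?thesis
    by (simp add: hessian_lagrangian_S[OF assms] sym inner_sum_left inner_sum_right
        inner_add_left inner_add_right)
      (intro sum.cong refl, simp add: inner_commute algebra_simps)
qed

theorem theorem7:
  fixes f :: "real^'n \<Rightarrow> real"
    and F1 F2 :: "real^'n \<Rightarrow> real^'k"
    and t :: "nat \<Rightarrow> real"
    and x :: "nat \<Rightarrow> real^'n"
    and \<eta> :: "nat \<Rightarrow> 'k \<Rightarrow> real"
    and xbar :: "real^'n"
    and \<sigma>1 \<sigma>2 \<rho>1 \<rho>2 :: "'k \<Rightarrow> real"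
    and q :: nat
  assumes "C2 f" and "C2_vec F1" and "C2_vec F2"
    and "\<And>i. t i > 0" and "t \<longlonglongrightarrow> 0"
    and "\<And>i. nondegenerate_KKT_S f F1 F2 (t i) (x i) (\<eta> i)"
    and "\<And>i. quadratic_index_S f F1 F2 (t i) (x i) (\<eta> i) = q"
    and "x \<longlonglongrightarrow> xbar"
    and "nondegenerate_C_stationary f F1 F2 xbar \<sigma>1 \<sigma>2 \<rho>1 \<rho>2"
  shows "CI f F1 F2 xbar \<sigma>1 \<sigma>2 \<rho>1 \<rho>2 = q"
proof -
  note smooth = assms(1-3) and kkt = assms(6) and x = assms(8) and cstat = assms(9)
  have C2F: "C2 (\<lambda>y. F1 y $ j)" "C2 (\<lambda>y. F2 y $ j)" for j
    using assms(2,3) by (auto simp: C2_vec_def)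
  define m1 where "m1 = multiplier1 F1 F2 xbar \<sigma>1 \<rho>1"
  define m2 where "m2 = multiplier2 F1 F2 xbar \<sigma>2 \<rho>2"
  define g1 where "g1 y j = grad (\<lambda>y. F1 y $ j) y" for y j
  define g2 where "g2 y j = grad (\<lambda>y. F2 y $ j) y" for y j
  define \<mu>1 where "\<mu>1 i j = - \<eta> i j * F2 (x i) $ j" for i j
  define \<mu>2 where "\<mu>2 i j = - \<eta> i j * F1 (x i) $ j" for i j
  let ?combination = "\<lambda>p1 p2 y. f y - (\<Sum>j\<in>UNIV. p1 j * F1 y $ j + p2 j * F2 y $ j)"
  define M where "M i = hessian (?combination (\<mu>1 i) (\<mu>2 i)) (x i)" for i
  define M0 where "M0 = hessian (lagrangian f F1 F2 xbar \<sigma>1 \<sigma>2 \<rho>1 \<rho>2) xbar"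
  have M0: "M0 = hessian (?combination m1 m2) xbar"
    by (simp add: M0_def lagrangian_eq m1_def m2_def)
  have feas: "xbar \<in> feasible F1 F2" and licq: "MPCC_LICQ F1 F2 xbar"
    and ndc2: "\<And>j. j \<in> a00 F1 F2 xbar \<Longrightarrow> \<rho>1 j * \<rho>2 j > 0"
    and ndc3: "nonsingular_on M0 (tangent_space F1 F2 xbar)"
    using cstat by (auto simp: nondegenerate_C_stationary_def C_stationary_def M0_def)
  have comp: "F1 xbar $ j * F2 xbar $ j = 0" and nonneg: "F1 xbar $ j \<ge> 0" "F2 xbar $ j \<ge> 0" for j
    using feas by (auto simp: feasible_def)
  note I1 = active_indices(1)[OF feas] and I2 = active_indices(2)[OF feas]
  have m: "m1 j = 0" if "F1 xbar $ j \<noteq> 0" for j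
    using that by (auto simp: m1_def multiplier1_def a01_def a00_def)
  have m': "m2 j = 0" if "F2 xbar $ j \<noteq> 0" for j
    using that by (auto simp: m2_def multiplier2_def a10_def a00_def)
  have m00: "m1 j = \<rho>1 j" "m2 j = \<rho>2 j" if "j \<in> a00 F1 F2 xbar" for j
    using that by (auto simp: m1_def m2_def multiplier1_def multiplier2_def a01_def a10_def a00_def)
  have stat: "grad f xbar = (\<Sum>j\<in>UNIV. m1 j *\<^sub>R g1 xbar j + m2 j *\<^sub>R g2 xbar j)"
    using cstat unfolding nondegenerate_C_stationary_def C_stationary_def m1_def m2_def g1_def g2_def
    by (simp add: multiplier_sum)
  have prod: "F1 (x i) $ j * F2 (x i) $ j = t i" "F1 (x i) $ j \<ge> 0" "F2 (x i) $ j \<ge> 0" for i j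
    using kkt[of i] by (auto simp: nondegenerate_KKT_S_def KKT_S_def feasible_S_def)
  have pos: "F1 (x i) $ j > 0" "F2 (x i) $ j > 0" for i j
    using prod[of i j] assms(4)[of i] by (auto simp: less_le)
  have stat_S: "grad f (x i) = (\<Sum>j\<in>UNIV. (- \<eta> i j * F2 (x i) $ j) *\<^sub>R g1 (x i) j
      + (- \<eta> i j * F1 (x i) $ j) *\<^sub>R g2 (x i) j)" for i
    using kkt[of i]
    by (simp add: nondegenerate_KKT_S_def KKT_S_def constraint_grad_S_def g1_def g2_def
        scaleR_add_right sum_negf[symmetric])
  have lims: "(\<lambda>i. F1 (x i) $ j) \<longlonglongrightarrow> F1 xbar $ j" "(\<lambda>i. F2 (x i) $ j) \<longlonglongrightarrow> F2 xbar $ j"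
    "(\<lambda>i. g1 (x i) j) \<longlonglongrightarrow> g1 xbar j" "(\<lambda>i. g2 (x i) j) \<longlonglongrightarrow> g2 xbar j" for j
    unfolding g1_def g2_def
    using C2_tendsto[OF C2F(1) x] C2_tendsto[OF C2F(2) x]
      C2_grad_tendsto[OF C2F(1) x] C2_grad_tendsto[OF C2F(2) x] by auto
  have ind: "independent_family (case_sum (g1 xbar) (g2 xbar))
      ({j. F1 xbar $ j = 0} <+> {j. F2 xbar $ j = 0})"
    using licq unfolding MPCC_LICQ_def I1 I2 g1_def g2_def .
  have "(\<lambda>i. \<Sum>j\<in>UNIV. (- \<eta> i j * F2 (x i) $ j) *\<^sub>R g1 (x i) j + (- \<eta> i j * F1 (x i) $ j) *\<^sub>R g2 (x i) j)
      \<longlonglongrightarrow> (\<Sum>j\<in>UNIV. m1 j *\<^sub>R g1 xbar j + m2 j *\<^sub>R g2 xbar j)"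
    unfolding stat_S[symmetric] stat[symmetric] by (rule C2_grad_tendsto[OF assms(1) x])
  from complementarity_multipliers_tendsto[OF lims pos comp m m' ind this]
  have \<mu>: "(\<lambda>i. \<mu>1 i j) \<longlonglongrightarrow> m1 j" "(\<lambda>i. \<mu>2 i j) \<longlonglongrightarrow> m2 j" for j
    by (simp_all add: \<mu>1_def \<mu>2_def)
  have limM: "M \<longlonglongrightarrow> M0"
    unfolding M0 M_def
    by (intro tendsto_matrixI, unfold hessian_linear_combination[OF smooth])
      (intro tendsto_diff tendsto_sum tendsto_add tendsto_scaleR tendsto_matrix_vector_mult
        tendsto_const \<mu> C2_hessian_tendsto[OF _ x] assms(1) C2F)
  interpret complementarity_smoothing sequentially "\<lambda>i j. F1 (x i) $ j" "\<lambda>i j. F2 (x i) $ j"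
    \<mu>1 \<mu>2 \<eta> "\<lambda>i. g1 (x i)" "\<lambda>i. g2 (x i)" M "\<lambda>j. F1 xbar $ j" "\<lambda>j. F2 xbar $ j" m1 m2
    "g1 xbar" "g2 xbar" M0
  proof (unfold_locales; (fact lims \<mu> limM pos comp nonneg)?)
    show "\<mu>1 i j = - \<eta> i j * F2 (x i) $ j" "\<mu>2 i j = - \<eta> i j * F1 (x i) $ j" for i j
      by (simp_all add: \<mu>1_def \<mu>2_def)
    show "m1 j * m2 j > 0" if "F1 xbar $ j = 0" "F2 xbar $ j = 0" for j
      using m00[of j] ndc2[of j] that by (simp add: a00_def)
  qed
  have T: "tangent i = tangent_space_S F1 F2 (x i)" for i
    by (simp add: tangent_def tangent_space_S_def constraint_grad_S_def g1_def g2_def)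
  have T0: "limit_tangent = tangent_space F1 F2 xbar"
    unfolding limit_tangent_def tangent_space_def I1 I2 by (auto simp: g1_def g2_def)
  define A where "A i = hessian (lagrangian_S f F1 F2 (t i) (\<eta> i)) (x i)" for i
  \<comment> \<open>The mixed gradient terms of the Hessian are exactly those that \<open>form\<close> adds to \<open>M\<close>.\<close>
  have form: "\<xi> \<bullet> (A i *v \<xi>) = form i \<xi>" for i \<xi>
    unfolding A_def M_def form_def hessian_lagrangian_S[OF smooth] hessian_linear_combination[OF smooth]
    by (simp add: inner_diff_right inner_add_right inner_sum_right \<mu>1_def \<mu>2_def g1_def g2_def
        sum_subtractf[symmetric] sum.distrib[symmetric] flip: sum_negf)
      (intro sum.cong refl, simp add: inner_commute algebra_simps)
  define P where "P = {j \<in> a00 F1 F2 xbar. \<rho>1 j > 0}"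
  define Q where "Q = {j \<in> a00 F1 F2 xbar. \<rho>1 j < 0}"
  have sign: "\<rho>1 j > 0 \<and> \<rho>2 j > 0 \<or> \<rho>1 j < 0 \<and> \<rho>2 j < 0" if "j \<in> a00 F1 F2 xbar" for j
    using ndc2[OF that] by (simp add: zero_less_mult_iff)
  have "{j \<in> a00 F1 F2 xbar. \<rho>1 j < 0 \<and> \<rho>2 j < 0} = Q"
    unfolding Q_def using sign by fastforce
  then have BI: "BI F1 F2 xbar \<rho>1 \<rho>2 = card Q" by (simp add: BI_def)
  have "a00 F1 F2 xbar = P \<union> Q" "P \<inter> Q = {}"
    unfolding P_def Q_def using sign by fastforce+
  then have PQ: "card (a00 F1 F2 xbar) = card P + card Q"
    by (simp add: card_Un_disjoint)
  have symM0: "(M0 *v u) \<bullet> v = u \<bullet> (M0 *v v)" for u v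
    unfolding M0_def by (rule hessian_lagrangian_symmetric[OF smooth])
  obtain N W where "inertia_splitting M0 (tangent_space F1 F2 xbar) N W"
    using inertia_splitting_exists[OF subspace_tangent_space symM0] by blast
  then have dimN: "dim N = num_neg_eigenvalues M0 (tangent_space F1 F2 xbar)"
    and dimT0: "dim N + dim W = dim (tangent_space F1 F2 xbar)"
    and N: "\<forall>v\<in>N. v \<noteq> 0 \<longrightarrow> v \<bullet> (M0 *v v) < 0"
    and W: "\<forall>v\<in>W. v \<noteq> 0 \<longrightarrow> v \<bullet> (M0 *v v) > 0"
    and perpW: "\<forall>v\<in>tangent_space F1 F2 xbar. (\<forall>w\<in>W. w \<bullet> v = 0) \<longrightarrow> v \<in> N"
    and perpN: "\<forall>v\<in>tangent_space F1 F2 xbar. (\<forall>w\<in>N. w \<bullet> v = 0) \<longrightarrow> v \<in> W"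
    using ndc3 by (simp_all add: inertia_splitting_def)
  have QI: "QI f F1 F2 xbar \<sigma>1 \<sigma>2 \<rho>1 \<rho>2 = dim N"
    by (simp add: QI_def dimN M0_def)
  \<comment> \<open>Negative side: switch off the terms that tend to \<open>+\<infinity>\<close> and the directions \<open>W\<close> where the form is positive.\<close>
  have "\<forall>\<^sub>F i in sequentially. \<exists>S. subspace S \<and> S \<subseteq> tangent i
    \<and> CARD('n) \<le> dim S + CARD('k) + card P + dim W \<and> (\<forall>\<xi>\<in>S. \<xi> \<noteq> 0 \<longrightarrow> 1 * form i \<xi> < 0)"
  proof (rule eventually_definite_subspace)
    show "j \<in> P \<or> 1 * m1 j < 0" if "F1 xbar $ j = 0" "F2 xbar $ j = 0" for j
      using that m00[of j] sign[of j] by (auto simp: P_def a00_def)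
  qed (use perpW N T0 in auto)
  \<comment> \<open>Positive side: switch off the terms that tend to \<open>-\<infinity>\<close> and the directions \<open>N\<close>.\<close>
  moreover have "\<forall>\<^sub>F i in sequentially. \<exists>S. subspace S \<and> S \<subseteq> tangent i
    \<and> CARD('n) \<le> dim S + CARD('k) + card Q + dim N \<and> (\<forall>\<xi>\<in>S. \<xi> \<noteq> 0 \<longrightarrow> -1 * form i \<xi> < 0)"
  proof (rule eventually_definite_subspace)
    show "j \<in> Q \<or> -1 * m1 j < 0" if "F1 xbar $ j = 0" "F2 xbar $ j = 0" for j
      using that m00[of j] sign[of j] by (auto simp: Q_def a00_def)
  qed (use perpN W T0 in auto)
  ultimately have "\<exists>i. (\<exists>S. subspace S \<and> S \<subseteq> tangent i
      \<and> CARD('n) \<le> dim S + CARD('k) + card P + dim W \<and> (\<forall>\<xi>\<in>S. \<xi> \<noteq> 0 \<longrightarrow> 1 * form i \<xi> < 0)) \<and>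
    (\<exists>S. subspace S \<and> S \<subseteq> tangent i
      \<and> CARD('n) \<le> dim S + CARD('k) + card Q + dim N \<and> (\<forall>\<xi>\<in>S. \<xi> \<noteq> 0 \<longrightarrow> -1 * form i \<xi> < 0))"
    by (intro eventually_happens'[OF sequentially_bot] eventually_conj)
  then obtain i S S' where S: "subspace S" "S \<subseteq> tangent i"
      "CARD('n) \<le> dim S + CARD('k) + card P + dim W"
    and negS: "\<forall>\<xi>\<in>S. \<xi> \<noteq> 0 \<longrightarrow> 1 * form i \<xi> < 0"
    and S': "subspace S'" "S' \<subseteq> tangent i"
      "CARD('n) \<le> dim S' + CARD('k) + card Q + dim N"
    and posS': "\<forall>\<xi>\<in>S'. \<xi> \<noteq> 0 \<longrightarrow> -1 * form i \<xi> < 0"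
    by (elim exE conjE) (rule that)
  have subT: "subspace (tangent i)" unfolding T by (rule subspace_tangent_space_S)
  have symA: "(A i *v u) \<bullet> v = u \<bullet> (A i *v v)" for u v
    unfolding A_def by (rule hessian_lagrangian_S_symmetric[OF smooth])
  obtain N' W' where "inertia_splitting (A i) (tangent i) N' W'"
    using inertia_splitting_exists[OF subT symA] by blast
  then have NW': "subspace N'" "N' \<subseteq> tangent i" "subspace W'" "W' \<subseteq> tangent i"
    and dimN': "dim N' = num_neg_eigenvalues (A i) (tangent i)"
    and dimT: "dim N' + dim W' = dim (tangent i)"
    and N': "\<forall>v\<in>N'. v \<noteq> 0 \<longrightarrow> v \<bullet> (A i *v v) < 0"
    and W': "\<forall>v\<in>W'. v \<bullet> (A i *v v) \<ge> 0"
    by (simp_all add: inertia_splitting_def)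
  have dimq: "dim N' = q"
    using assms(7)[of i] by (simp add: dimN' quadratic_index_S_def A_def T)
  have dimTi: "dim (tangent i) + CARD('k) = CARD('n)"
    unfolding T using kkt[of i] by (intro dim_tangent_space_S) (simp add: nondegenerate_KKT_S_def)
  have "\<xi> = 0" if "\<xi> \<in> S \<inter> W'" for \<xi>
    using bspec[OF negS, of \<xi>] bspec[OF W', of \<xi>] that by (auto simp: form)
  then have "S \<inter> W' \<subseteq> {0}" by blast
  from dim_trivial_intersection[OF S(1) NW'(3) subT S(2) NW'(4) this]
  have lower: "dim S \<le> q" using dimT dimq by simp
  have "\<xi> = 0" if "\<xi> \<in> S' \<inter> N'" for \<xi>
    using bspec[OF posS', of \<xi>] bspec[OF N', of \<xi>] that by (auto simp: form)
  then have "S' \<inter> N' \<subseteq> {0}" by blast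
  from dim_trivial_intersection[OF S'(1) NW'(1) subT S'(2) NW'(2) this]
  have upper: "dim S' + q \<le> dim (tangent i)" using dimq by simp
  show ?thesis
    unfolding CI_def QI BI
    using lower upper S(3) S'(3) dimTi dimT0 dim_tangent_space[OF feas licq] PQ by linarith
qed

end
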